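(* Let $\mathscr{H}$ be a complex Hilbert space and let $A,B\in \mathbb{B}(\mathscr{H})$. Then for all real $\alpha\in[0,1]$ and all real $r\geq 1$, $$w^{2r}\begin{pmatrix} O&A\\ B&O\end{pmatrix} \leq \frac{1}{4}\max\Big\{ \big\| |B|^{2r}+|A^*|^{2r}\big\|,\ \big\| |A|^{2r}+|B^*|^{2r}\big\|\Big\}+\frac{1-\alpha}{2}\max\Big\{w^r(AB),\, w^r(BA)\Big\}+\frac{\alpha}{2}\max\Big\{\big\|\Re(|B|^r|A^*|^r)\big\|,\ \big\|\Re(|A|^r|B^*|^r)\big\|\Big\}.$$
   Context: $\mathbb{B}(\mathscr{H})$ is the $C^*$-algebra of bounded linear operators on the complex Hilbert space $\mathscr{H}$, and $O$ is the zero operator. For a bounded operator $T$ on a complex Hilbert space: $\|T\|$ is the operator norm; $|T|=(T^*T)^{1/2}$ is the positive square root of $T^*T$ (so $|T^*|=(TT^* )^{1/2}$), with powers $|T|^s$ taken by the functional calculus; $\Re(T)=\frac12(T+T^* )$; the numerical radius is $w(T)=\sup\{|\langle Tx,x\rangle| : \|x\|=1\}$, and $w^s(T)$ means $(w(T))^s$. The operator matrix $\begin{pmatrix} O&A\\ B&O\end{pmatrix}$ is the operator $(x,y)\mapsto (Ay,Bx)$ on the Hilbert space direct sum $\mathscr{H}\oplus\mathscr{H}$. *)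

theory Defs
  imports "HOL-Analysis.Analysis" "HOL-Computational_Algebra.Polynomial"
begin

section \<open>Complex Hilbert spaces\<close>

text \<open>
  The distribution only has real inner product spaces.  A complex Hilbert space is here a
  (real) Banach space with a complex scalar multiplication extending the real one and a
  sesquilinear form, linear in the first argument, that induces the norm.  Positive
  definiteness of the form follows from the last axiom.
\<close>

class complex_hilbert = banach +
  fixes scaleC :: "complex \<Rightarrow> 'a \<Rightarrow> 'a" (infixr \<open>*C\<close> 75)
    and cinner :: "'a \<Rightarrow> 'a \<Rightarrow> complex"
  assumes scaleC_add_right: "c *C (x + y) = c *C x + c *C y"
    and scaleC_add_left: "(c + d) *C x = c *C x + d *C x"
    and scaleC_scaleC: "c *C (d *C x) = (c * d) *C x"
    and scaleC_of_real: "complex_of_real r *C x = r *\<^sub>R x"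
    and cinner_commute: "cinner x y = cnj (cinner y x)"
    and cinner_add_left: "cinner (x + y) z = cinner x z + cinner y z"
    and cinner_scaleC_left: "cinner (c *C x) y = c * cinner x y"
    and cinner_self: "cinner x x = complex_of_real ((norm x)\<^sup>2)"

lemma norm_scaleC: "norm (c *C x) = cmod c * norm (x :: 'a::complex_hilbert)"
proof -
  have "cinner (c *C x) (c *C x) = c * cnj (cinner (c *C x) x)"
    by (metis cinner_commute cinner_scaleC_left)
  also have "\<dots> = (c * cnj c) * cinner x x"
    by (simp add: cinner_scaleC_left cinner_self)
  finally have "complex_of_real ((norm (c *C x))\<^sup>2) = complex_of_real ((cmod c * norm x)\<^sup>2)"
    by (simp only: cinner_self complex_norm_square[symmetric] of_real_mult[symmetric] power_mult_distrib)
  then have "(norm (c *C x))\<^sup>2 = (cmod c * norm x)\<^sup>2"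
    by (simp only: of_real_eq_iff)
  then show ?thesis
    by (simp add: power2_eq_iff_nonneg)
qed

text \<open>
  The Hilbert space direct sum; the norm inherited from the library is
  \<open>sqrt ((norm x)\<^sup>2 + (norm y)\<^sup>2)\<close>.
\<close>

instantiation prod :: (complex_hilbert, complex_hilbert) complex_hilbert
begin

definition scaleC_prod :: "complex \<Rightarrow> 'a \<times> 'b \<Rightarrow> 'a \<times> 'b" where
  "scaleC_prod c z = (c *C fst z, c *C snd z)"

definition cinner_prod :: "'a \<times> 'b \<Rightarrow> 'a \<times> 'b \<Rightarrow> complex" where
  "cinner_prod z z' = cinner (fst z) (fst z') + cinner (snd z) (snd z')"

instance
proof
  fix c d :: complex and r :: real and x y z :: "'a \<times> 'b"
  show "c *C (x + y) = c *C x + c *C y"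
    by (simp add: scaleC_prod_def scaleC_add_right)
  show "(c + d) *C x = c *C x + d *C x"
    by (simp add: scaleC_prod_def scaleC_add_left)
  show "c *C (d *C x) = (c * d) *C x"
    by (simp add: scaleC_prod_def scaleC_scaleC)
  show "complex_of_real r *C x = r *\<^sub>R x"
    by (simp add: scaleC_prod_def scaleC_of_real scaleR_prod_def)
  show "cinner x y = cnj (cinner y x)"
    by (metis cinner_prod_def cinner_commute complex_cnj_add)
  show "cinner (x + y) z = cinner x z + cinner y z"
    by (simp add: cinner_prod_def cinner_add_left)
  show "cinner (c *C x) y = c * cinner x y"
    by (simp add: cinner_prod_def scaleC_prod_def cinner_scaleC_left distrib_left)
  show "cinner x x = complex_of_real ((norm x)\<^sup>2)"
    by (simp add: cinner_prod_def cinner_self norm_prod_def)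
qed

end

section \<open>Bounded operators\<close>

text \<open>
  The type \<open>'a \<Rightarrow>\<^sub>L 'a\<close> contains all bounded real-linear maps; the bounded operators of a
  complex Hilbert space are the complex-linear ones among them.  Norm, sum, real multiples
  and composition are those of the library.
\<close>

definition clinear_op :: "('a::complex_hilbert \<Rightarrow>\<^sub>L 'a) \<Rightarrow> bool" where
  "clinear_op T \<longleftrightarrow> (\<forall>c x. blinfun_apply T (c *C x) = c *C blinfun_apply T x)"

definition adj :: "('a::complex_hilbert \<Rightarrow>\<^sub>L 'a) \<Rightarrow> ('a \<Rightarrow>\<^sub>L 'a)" where
  "adj T = (THE S. \<forall>x y. cinner (blinfun_apply T x) y = cinner x (blinfun_apply S y))"

definition Re_op :: "('a::complex_hilbert \<Rightarrow>\<^sub>L 'a) \<Rightarrow> ('a \<Rightarrow>\<^sub>L 'a)" where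
  "Re_op T = (1 / 2) *\<^sub>R (T + adj T)"

text \<open>
  All members of the set below are nonnegative, so inserting \<open>0\<close> only matters for the zero
  space, where there is no unit vector and the supremum is read as \<open>0\<close>.
\<close>

definition numerical_radius :: "('a::complex_hilbert \<Rightarrow>\<^sub>L 'a) \<Rightarrow> real" where
  "numerical_radius T = Sup (insert 0 {cmod (cinner (blinfun_apply T x) x) | x. norm x = 1})"

definition antidiag_op ::
    "('a::complex_hilbert \<Rightarrow>\<^sub>L 'a) \<Rightarrow> ('a \<Rightarrow>\<^sub>L 'a) \<Rightarrow> (('a \<times> 'a) \<Rightarrow>\<^sub>L ('a \<times> 'a))" where
  "antidiag_op A B = Blinfun (\<lambda>z. (blinfun_apply A (snd z), blinfun_apply B (fst z)))"

lemma antidiag_op_apply [simp]: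
  "blinfun_apply (antidiag_op A B) (x, y) = (blinfun_apply A y, blinfun_apply B x)"
proof -
  have "bounded_linear (\<lambda>z. (blinfun_apply A (snd z), blinfun_apply B (fst z)))"
    by (intro bounded_linear_Pair bounded_linear_compose[OF blinfun.bounded_linear_right]
        bounded_linear_fst bounded_linear_snd)
  then show ?thesis
    by (simp add: antidiag_op_def bounded_linear_Blinfun_apply)
qed

definition positive_op :: "('a::complex_hilbert \<Rightarrow>\<^sub>L 'a) \<Rightarrow> bool" where
  "positive_op T \<longleftrightarrow> clinear_op T \<and>
     (\<forall>x. cinner (blinfun_apply T x) x \<in> \<real> \<and> 0 \<le> Re (cinner (blinfun_apply T x) x))"

definition abs_op :: "('a::complex_hilbert \<Rightarrow>\<^sub>L 'a) \<Rightarrow> ('a \<Rightarrow>\<^sub>L 'a)" where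
  "abs_op T = (THE P. positive_op P \<and> P o\<^sub>L P = adj T o\<^sub>L T)"

section \<open>Functional calculus and powers\<close>

definition scalar_op :: "complex \<Rightarrow> ('a::complex_hilbert \<Rightarrow>\<^sub>L 'a)" where
  "scalar_op c = Blinfun (\<lambda>x. c *C x)"

lemma scalar_op_apply [simp]: "blinfun_apply (scalar_op c) x = c *C x"
proof -
  have "bounded_linear (\<lambda>x::'a. c *C x)"
  proof (rule bounded_linear_intro[where K = "cmod c"])
    show "c *C (r *\<^sub>R x) = r *\<^sub>R (c *C x)" for r and x :: 'a
      by (simp add: scaleC_of_real[symmetric] scaleC_scaleC mult.commute)
  qed (simp_all add: scaleC_add_right norm_scaleC mult.commute)
  then show ?thesis
    by (simp add: scalar_op_def bounded_linear_Blinfun_apply)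
qed

definition invertible_op :: "('a::complex_hilbert \<Rightarrow>\<^sub>L 'a) \<Rightarrow> bool" where
  "invertible_op T \<longleftrightarrow>
     (\<exists>S. clinear_op S \<and> S o\<^sub>L T = id_blinfun \<and> T o\<^sub>L S = id_blinfun)"

definition op_spectrum :: "('a::complex_hilbert \<Rightarrow>\<^sub>L 'a) \<Rightarrow> complex set" where
  "op_spectrum T = {c. \<not> invertible_op (T - scalar_op c)}"

definition poly_op :: "real poly \<Rightarrow> ('a::complex_hilbert \<Rightarrow>\<^sub>L 'a) \<Rightarrow> ('a \<Rightarrow>\<^sub>L 'a)" where
  "poly_op p T = (\<Sum>i\<le>degree p. coeff p i *\<^sub>R (((\<lambda>S. T o\<^sub>L S) ^^ i) id_blinfun))"

text \<open>
  Continuous functional calculus for a self-adjoint \<open>T\<close> (whose spectrum is a compact set of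
  real numbers) and a real function \<open>f\<close> continuous on the spectrum: \<open>f(T)\<close> is the norm limit
  of \<open>p\<^sub>n(T)\<close> for any polynomials \<open>p\<^sub>n\<close> converging to \<open>f\<close> uniformly on the spectrum.
\<close>

definition fun_calc :: "(real \<Rightarrow> real) \<Rightarrow> ('a::complex_hilbert \<Rightarrow>\<^sub>L 'a) \<Rightarrow> ('a \<Rightarrow>\<^sub>L 'a)" where
  "fun_calc f T = (THE S. \<exists>p :: nat \<Rightarrow> real poly.
     uniform_limit {t. complex_of_real t \<in> op_spectrum T} (\<lambda>n. poly (p n)) f sequentially \<and>
     (\<lambda>n. poly_op (p n) T) \<longlonglongrightarrow> S)"

definition powr_op :: "('a::complex_hilbert \<Rightarrow>\<^sub>L 'a) \<Rightarrow> real \<Rightarrow> ('a \<Rightarrow>\<^sub>L 'a)" where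
  "powr_op T s = fun_calc (\<lambda>t. t powr s) T"

end

theory Submission
  imports Defs "HOL-Computational_Algebra.Fundamental_Theorem_Algebra"
begin

text \<open>
  Put \<open>T = antidiag_op A B\<close>, so that \<open>T\<^sup>2 = A B \<oplus> B A\<close>, \<open>\<bar>T\<bar> = \<bar>B\<bar> \<oplus> \<bar>A\<bar>\<close> and
  \<open>\<bar>T\<^sup>*\<bar> = \<bar>A\<^sup>*\<bar> \<oplus> \<bar>B\<^sup>*\<bar>\<close>.  For a unit vector \<open>e\<close> the number \<open>\<bar>\<langle>T e, e\<rangle>\<bar>\<^sup>2\<^sup>r\<close> is bounded in two ways.
  Buzano's inequality gives the bound for \<open>\<alpha> = 0\<close> (\<open>antidiag_Buzano_bound\<close>), the mixed Schwarz
  inequality \<open>\<bar>\<langle>T e, e\<rangle>\<bar>\<^sup>2 \<le> \<langle>\<bar>T\<bar> e, e\<rangle> \<langle>\<bar>T\<^sup>*\<bar> e, e\<rangle>\<close> the one for \<open>\<alpha> = 1\<close> (\<open>antidiag_Schwarz_bound\<close>); the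
  theorem is their convex combination.  In both, powers are moved inside the inner product by
  Jensen's inequality \<open>\<langle>P x, x\<rangle>\<^sup>r \<le> \<langle>P\<^sup>r x, x\<rangle>\<close> for positive \<open>P\<close> (\<open>Jensen_direct_sum\<close>).  All inequalities
  are written in the components \<open>e = (x, y)\<close>, which avoids computing functions of block operators.

  The operator theory behind this rests on polynomials.  The key fact is that a real polynomial of a
  self-adjoint operator satisfies \<open>\<parallel>p(T)\<parallel> \<le> sup \<bar>p\<bar>\<close>, the supremum taken over the approximate point
  spectrum (\<open>norm_poly_op_le\<close>): with \<open>M = \<parallel>p(T)\<parallel>\<close> the operator \<open>M\<^sup>2 - p(T)\<^sup>2\<close> is not bounded below, hence
  neither is one of the factors \<open>T - t\<close> with \<open>t\<close> a root of \<open>M\<^sup>2 - p\<^sup>2\<close>.  Consequently polynomials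
  nonnegative on the spectrum give positive operators (\<open>poly_op_nonneg\<close>), uniformly convergent
  polynomials give convergent operators (\<open>poly_op_convergent\<close>), and the limit only depends on the
  limit function (\<open>poly_op_limit_unique\<close>).  With Weierstrass approximation this identifies the powers
  (\<open>tendsto_fun_calc\<close>), and approximating \<open>sqrt\<close> yields existence and uniqueness of \<open>\<bar>A\<bar>\<close>.  The mixed
  Schwarz inequality is the operator inequality \<open>J \<le> \<bar>J\<bar>\<close> for the self-adjoint
  \<open>J (x, y) = (A\<^sup>* y, A x)\<close> (\<open>mixed_arithmetic_mean\<close>), obtained from polynomials as well.
\<close>

section \<open>Geometry of a complex Hilbert space\<close>

lemma cinner_add_right: "cinner (x::'a::complex_hilbert) (y + z) = cinner x y + cinner x z"
  by (metis cinner_commute cinner_add_left complex_cnj_add)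

lemma cinner_scaleC_right: "cinner (x::'a::complex_hilbert) (c *C y) = cnj c * cinner x y"
  by (metis cinner_commute cinner_scaleC_left complex_cnj_mult)

lemma cinner_scaleR_left: "cinner (r *\<^sub>R x) (y::'a::complex_hilbert) = r *\<^sub>R cinner x y"
  by (simp add: scaleC_of_real[symmetric] cinner_scaleC_left scaleR_conv_of_real)

lemma cinner_scaleR_right: "cinner (x::'a::complex_hilbert) (r *\<^sub>R y) = r *\<^sub>R cinner x y"
  by (simp add: scaleC_of_real[symmetric] cinner_scaleC_right scaleR_conv_of_real)

lemma cinner_minus_left: "cinner (- x) (y::'a::complex_hilbert) = - cinner x y"
  using cinner_scaleR_left[of "-1" x y] by simp

lemma cinner_minus_right: "cinner (x::'a::complex_hilbert) (- y) = - cinner x y"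
  using cinner_scaleR_right[of x "-1" y] by simp

lemma cinner_diff_left: "cinner (x - y) (z::'a::complex_hilbert) = cinner x z - cinner y z"
  using cinner_add_left[of x "- y" z] by (simp add: cinner_minus_left)

lemma cinner_diff_right: "cinner (x::'a::complex_hilbert) (y - z) = cinner x y - cinner x z"
  using cinner_add_right[of x y "- z"] by (simp add: cinner_minus_right)

lemmas cinner_simps = cinner_add_left cinner_add_right cinner_diff_left cinner_diff_right
  cinner_minus_left cinner_minus_right cinner_scaleR_left cinner_scaleR_right
  cinner_scaleC_left cinner_scaleC_right

lemma Re_cinner_commute: "Re (cinner x y) = Re (cinner y (x::'a::complex_hilbert))"
  by (subst cinner_commute) simp

lemma Re_cinner_self: "Re (cinner x x) = (norm (x::'a::complex_hilbert))\<^sup>2"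
  by (simp add: cinner_self)

lemma norm_add_sq:
  "(norm (x + y))\<^sup>2 = (norm x)\<^sup>2 + (norm (y::'a::complex_hilbert))\<^sup>2 + 2 * Re (cinner x y)"
  using Re_cinner_commute[of x y] by (simp add: Re_cinner_self[symmetric] cinner_simps)

lemma norm_diff_sq:
  "(norm (x - y))\<^sup>2 = (norm x)\<^sup>2 + (norm (y::'a::complex_hilbert))\<^sup>2 - 2 * Re (cinner x y)"
  using norm_add_sq[of x "- y"] by (simp add: cinner_simps)

lemma Cauchy_Schwarz: "cmod (cinner x y) \<le> norm x * norm (y::'a::complex_hilbert)"
proof (cases "y = 0")
  case True
  then show ?thesis using cinner_scaleR_right[of x 0 y] by simp
next
  case False
  let ?c = "cinner x y" and ?n = "(norm y)\<^sup>2"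
  have "0 \<le> (norm (?n *\<^sub>R x - ?c *C y))\<^sup>2" by simp
  also have "\<dots> = ?n\<^sup>2 * (norm x)\<^sup>2 + (cmod ?c)\<^sup>2 * ?n - 2 * (?n * Re (cnj ?c * ?c))"
    by (simp add: norm_diff_sq norm_scaleC power_mult_distrib cinner_simps)
  also have "Re (cnj ?c * ?c) = (cmod ?c)\<^sup>2"
    by (metis complex_norm_square mult.commute Re_complex_of_real)
  finally have "0 \<le> ?n * (?n * (norm x)\<^sup>2 - (cmod ?c)\<^sup>2)"
    by (simp add: algebra_simps power2_eq_square)
  then have "(cmod ?c)\<^sup>2 \<le> (norm x * norm y)\<^sup>2"
    using False by (simp add: zero_le_mult_iff power_mult_distrib mult.commute)
  then show ?thesis
    by (rule power2_le_imp_le) simp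
qed

lemma Re_Cauchy_Schwarz: "Re (cinner x y) \<le> norm x * norm (y::'a::complex_hilbert)"
  using Cauchy_Schwarz[of x y] complex_Re_le_cmod[of "cinner x y"] by linarith

lemma bounded_bilinear_cinner:
  "bounded_bilinear (cinner :: 'a::complex_hilbert \<Rightarrow> 'a \<Rightarrow> complex)"
  by (rule bounded_bilinear.intro)
     (auto simp: cinner_simps intro!: exI[of _ 1] Cauchy_Schwarz)

lemmas tendsto_cinner [tendsto_intros] = bounded_bilinear.tendsto[OF bounded_bilinear_cinner]

lemma cinner_zero_left [simp]: "cinner 0 (x::'a::complex_hilbert) = 0"
  by (rule bounded_bilinear.zero_left[OF bounded_bilinear_cinner])

lemma cinner_zero_right [simp]: "cinner (x::'a::complex_hilbert) 0 = 0"
  by (rule bounded_bilinear.zero_right[OF bounded_bilinear_cinner])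

lemma cinner_ext:
  assumes "\<And>z. cinner z x = cinner z (y::'a::complex_hilbert)"
  shows "x = y"
  using assms[of "x - y"] Re_cinner_self[of "x - y"] by (simp add: cinner_simps)

text \<open>
  The representing vector of a real functional \<open>f\<close> is the minimiser of
  \<open>\<parallel>x\<parallel>\<^sup>2 - 2 f x\<close>: by the parallelogram law minimising sequences are Cauchy, and stationarity
  at the minimiser is the representation property.
\<close>

lemma Riesz_real:
  fixes f :: "'a::complex_hilbert \<Rightarrow> real"
  assumes "bounded_linear f"
  obtains u where "\<And>x. f x = Re (cinner x u)"
proof -
  interpret f: bounded_linear f by fact
  define J where "J x = (norm x)\<^sup>2 - 2 * f x" for x
  obtain C where C: "\<And>x. \<bar>f x\<bar> \<le> norm x * C"
    using f.bounded by auto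
  have bound: "- (C\<^sup>2) \<le> J x" for x
  proof -
    have "f x \<le> norm x * C" using C[of x] by linarith
    moreover have "0 \<le> (norm x - C)\<^sup>2" by simp
    ultimately show ?thesis by (simp add: J_def power2_eq_square algebra_simps)
  qed
  define m where "m = Inf (range J)"
  have bdd: "bdd_below (range J)"
    using bound by (auto simp: bdd_below_def)
  have m_le: "m \<le> J x" for x
    unfolding m_def using bdd by (simp add: cINF_lower)
  have "\<exists>x. J x < m + 1 / (real n + 1)" for n
    using cInf_lessD[of "range J" "m + 1 / (real n + 1)"] unfolding m_def[symmetric] by auto
  then obtain X where X: "\<And>n. J (X n) < m + 1 / (real n + 1)" by metis
  have par: "(norm (x - y))\<^sup>2 \<le> 2 * (J x - m) + 2 * (J y - m)" for x y
  proof -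
    have "m \<le> J ((1/2) *\<^sub>R (x + y))" by (rule m_le)
    also have "\<dots> = (norm (x + y))\<^sup>2 / 4 - f x - f y"
      by (simp add: J_def f.scaleR f.add power_divide add_divide_distrib)
    finally have "4 * m \<le> (norm (x + y))\<^sup>2 - 4 * f x - 4 * f y" by simp
    moreover have "(norm (x + y))\<^sup>2 + (norm (x - y))\<^sup>2 = 2 * (norm x)\<^sup>2 + 2 * (norm y)\<^sup>2"
      by (simp add: norm_add_sq norm_diff_sq)
    ultimately show ?thesis by (simp add: J_def)
  qed
  have "Cauchy X"
  proof (rule metric_CauchyI)
    fix e :: real assume e: "0 < e"
    obtain N where N: "4 / e\<^sup>2 < real N" using reals_Archimedean2 by blast
    have N0: "0 < real N" by (rule le_less_trans[OF _ N]) simp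
    have small: "4 * (J (X k) - m) < e\<^sup>2" if "N \<le> k" for k
    proof -
      have "1 / (real k + 1) \<le> 1 / real N" using that N0 by (intro divide_left_mono) auto
      also have "\<dots> < e\<^sup>2 / 4" using N N0 e by (simp add: field_simps)
      finally show ?thesis using X[of k] by simp
    qed
    show "\<exists>M. \<forall>i\<ge>M. \<forall>j\<ge>M. dist (X i) (X j) < e"
    proof (intro exI[of _ N] allI impI)
      fix i j assume "N \<le> i" "N \<le> j"
      then have "(norm (X i - X j))\<^sup>2 < e\<^sup>2"
        using par[of "X i" "X j"] small[OF \<open>N \<le> i\<close>] small[OF \<open>N \<le> j\<close>] by simp
      then show "dist (X i) (X j) < e"
        using e by (simp add: dist_norm power_less_imp_less_base)
    qed
  qed
  then obtain u where u: "X \<longlonglongrightarrow> u" using Cauchy_convergent convergent_def by blast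
  have "(\<lambda>n. J (X n)) \<longlonglongrightarrow> J u"
    unfolding J_def by (intro tendsto_intros u f.tendsto)
  moreover have "(\<lambda>n. m + 1 / (real n + 1)) \<longlonglongrightarrow> m + 0"
    by (intro tendsto_intros) (use LIMSEQ_inverse_real_of_nat in \<open>simp add: inverse_eq_divide add.commute\<close>)
  ultimately have "J u \<le> m + 0"
    by (rule LIMSEQ_le) (use X less_imp_le in blast)
  then have Ju: "J u \<le> J y" for y using m_le[of y] by simp
  have "f x = Re (cinner x u)" for x
  proof -
    let ?d = "Re (cinner u x) - f x"
    have var: "0 \<le> 2 * (t * ?d) + t\<^sup>2 * (norm x)\<^sup>2" for t
      using Ju[of "u + t *\<^sub>R x"]
      by (simp add: J_def norm_add_sq f.add f.scaleR cinner_simps power_mult_distrib algebra_simps)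
    have "?d = 0"
    proof (rule ccontr)
      assume d: "?d \<noteq> 0"
      \<comment> \<open>\<open>t = - d / N\<close> nearly minimises the quadratic; the summand \<open>1\<close> in \<open>N\<close> covers \<open>x = 0\<close>\<close>
      define N d where "N = (norm x)\<^sup>2 + 1" and "d = ?d"
      have N: "0 < N" by (simp add: N_def add_nonneg_pos)
      have "2 * ((- d / N) * d) + (- d / N)\<^sup>2 * (norm x)\<^sup>2
          \<le> 2 * ((- d / N) * d) + (- d / N)\<^sup>2 * N"
        by (intro add_left_mono mult_left_mono) (auto simp: N_def)
      also have "\<dots> = - (d\<^sup>2 / N)" using N by (simp add: power2_eq_square)
      also have "\<dots> < 0" using d N by (simp add: d_def)
      finally show False using var[of "- d / N"] by (simp add: d_def)
    qed
    then show ?thesis by (simp add: Re_cinner_commute[of x u])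
  qed
  then show thesis by (rule that)
qed

section \<open>Adjoints\<close>

lemma adj_exists:
  fixes T :: "'a::complex_hilbert \<Rightarrow>\<^sub>L 'a"
  assumes T: "clinear_op T"
  obtains S where "\<And>x y. cinner (T x) y = cinner x (blinfun_apply S y)"
proof -
  have "\<exists>u. \<forall>x. cinner (T x) y = cinner x u" for y
  proof -
    have "bounded_linear (\<lambda>x. Re (cinner (T x) y))"
      by (intro bounded_linear_compose[OF bounded_linear_Re]
          bounded_linear_compose[OF bounded_bilinear.bounded_linear_left[OF bounded_bilinear_cinner]]
          blinfun.bounded_linear_right)
    then obtain u where u: "\<And>x. Re (cinner (T x) y) = Re (cinner x u)"
      using Riesz_real by blast
    have "cinner (T x) y = cinner x u" for x
    proof (rule complex_eqI)
      show "Re (cinner (T x) y) = Re (cinner x u)" by (rule u)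
      show "Im (cinner (T x) y) = Im (cinner x u)"
        using u[of "\<i> *C x"] T by (simp add: clinear_op_def cinner_simps)
    qed
    then show ?thesis by blast
  qed
  then obtain S where S: "\<And>x y. cinner (T x) y = cinner x (S y)" by metis
  have "bounded_linear S"
  proof (rule bounded_linear_intro[where K = "norm T"])
    show "S (x + y) = S x + S y" for x y
      by (rule cinner_ext) (simp add: S[symmetric] cinner_simps)
    show "S (r *\<^sub>R x) = r *\<^sub>R S x" for r x
      by (rule cinner_ext) (simp add: S[symmetric] cinner_simps)
    show "norm (S y) \<le> norm y * norm T" for y
    proof (cases "S y = 0")
      case False
      have "(norm (S y))\<^sup>2 = Re (cinner (T (S y)) y)"
        by (simp add: S Re_cinner_self)
      also have "\<dots> \<le> norm (T (S y)) * norm y" by (rule Re_Cauchy_Schwarz)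
      also have "\<dots> \<le> (norm T * norm (S y)) * norm y"
        by (intro mult_right_mono norm_blinfun) simp
      finally show ?thesis using False by (simp add: power2_eq_square mult.commute)
    qed simp
  qed
  then show thesis
    using that[of "Blinfun S"] S by (simp add: bounded_linear_Blinfun_apply)
qed

lemma adj_unique:
  fixes T S :: "'a::complex_hilbert \<Rightarrow>\<^sub>L 'a"
  assumes "\<And>x y. cinner (T x) y = cinner x (S y)"
  shows "adj T = S"
  unfolding adj_def
proof (rule the_equality)
  show "\<forall>x y. cinner (T x) y = cinner x (S y)" using assms by blast
  fix R assume "\<forall>x y. cinner (T x) y = cinner x (blinfun_apply R y)"
  then have "\<And>z y. cinner z (R y) = cinner z (S y)" using assms by metis
  then show "R = S" by (intro blinfun_eqI cinner_ext) simp
qed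

lemma cinner_adj_right:
  fixes T :: "'a::complex_hilbert \<Rightarrow>\<^sub>L 'a"
  assumes "clinear_op T"
  shows "cinner x (adj T y) = cinner (T x) y"
  using adj_exists[OF assms] adj_unique by metis

lemma cinner_adj_left:
  fixes T :: "'a::complex_hilbert \<Rightarrow>\<^sub>L 'a"
  assumes "clinear_op T"
  shows "cinner (adj T x) y = cinner x (T y)"
  using cinner_adj_right[OF assms, of y x] by (metis cinner_commute)

lemma clinear_op_adj:
  fixes T :: "'a::complex_hilbert \<Rightarrow>\<^sub>L 'a"
  assumes "clinear_op T"
  shows "clinear_op (adj T)"
  unfolding clinear_op_def
  by (intro allI cinner_ext) (simp add: cinner_adj_right[OF assms] cinner_simps)

lemma adj_adj:
  fixes T :: "'a::complex_hilbert \<Rightarrow>\<^sub>L 'a"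
  assumes "clinear_op T"
  shows "adj (adj T) = T"
  by (rule adj_unique) (simp add: cinner_adj_left[OF assms])

definition self_adjoint :: "('a::complex_hilbert \<Rightarrow>\<^sub>L 'a) \<Rightarrow> bool" where
  "self_adjoint T \<longleftrightarrow> (\<forall>x y. cinner (T x) y = cinner x (T y))"

lemma self_adjointD: "self_adjoint T \<Longrightarrow> cinner (blinfun_apply T x) y = cinner x (blinfun_apply T y)"
  by (simp add: self_adjoint_def)

text \<open>Polarisation: a form that is real on the diagonal is Hermitian.\<close>

lemma positive_op_self_adjoint:
  fixes T :: "'a::complex_hilbert \<Rightarrow>\<^sub>L 'a"
  assumes "positive_op T"
  shows "self_adjoint T"
  unfolding self_adjoint_def
proof (intro allI)
  fix x y
  have lin: "T (c *C z) = c *C T z" for c z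
    using assms by (simp add: positive_op_def clinear_op_def)
  have "cinner (T z) z \<in> \<real>" for z
    using assms by (simp add: positive_op_def)
  then have real: "Im (cinner (T z) z) = 0" for z by (simp add: complex_is_Real_iff)
  have "Im (cinner (T x) y) + Im (cinner (T y) x) = 0"
    using real[of "x + y"] by (simp add: blinfun.add_right cinner_simps real)
  moreover have "Re (cinner (T x) y) = Re (cinner (T y) x)"
    using real[of "\<i> *C x + y"] by (simp add: blinfun.add_right lin cinner_simps real)
  ultimately have "cinner (T x) y = cnj (cinner (T y) x)" by (simp add: complex_eq_iff)
  then show "cinner (T x) y = cinner x (T y)" by (metis cinner_commute)
qed

lemma positive_op_adj_compose:
  fixes T :: "'a::complex_hilbert \<Rightarrow>\<^sub>L 'a"
  assumes "clinear_op T"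
  shows "positive_op (adj T o\<^sub>L T)"
  using assms clinear_op_adj[OF assms]
  by (simp add: positive_op_def clinear_op_def cinner_adj_left cinner_self)

section \<open>Real polynomials of an operator\<close>

lemma poly_op_0 [simp]: "poly_op 0 T = 0"
  by (simp add: poly_op_def)

lemma poly_op_pCons:
  "poly_op (pCons a p) T = a *\<^sub>R id_blinfun + (T o\<^sub>L poly_op p T)"
proof (cases "p = 0")
  case True
  then show ?thesis by (simp add: poly_op_def degree_pCons_eq_if)
next
  case False
  then show ?thesis
    by (intro blinfun_eqI)
       (simp add: poly_op_def sum.atMost_Suc_shift blinfun.sum_left blinfun.sum_right
          blinfun.add_left blinfun.scaleR_left blinfun.scaleR_right
          del: sum.atMost_Suc)
qed

lemma poly_op_add: "poly_op (p + q) T = poly_op p T + poly_op q T"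
proof (induction p q rule: poly_induct2)
  case (pCons a p b q)
  then show ?case
    by (intro blinfun_eqI)
       (simp add: poly_op_pCons blinfun.add_left blinfun.add_right blinfun.scaleR_left algebra_simps)
qed simp

lemma poly_op_smult: "poly_op (smult c p) T = c *\<^sub>R poly_op p T"
proof (induction p)
  case (pCons a p)
  then show ?case
    by (intro blinfun_eqI)
       (simp add: poly_op_pCons blinfun.add_left blinfun.add_right blinfun.scaleR_left
          blinfun.scaleR_right scaleR_add_right)
qed simp

lemma poly_op_diff: "poly_op (p - q) T = poly_op p T - poly_op q T"
  using poly_op_add[of p "smult (-1) q" T] by (simp only: poly_op_smult) simp

lemma poly_op_const: "poly_op [:c:] T = c *\<^sub>R id_blinfun"
  by (intro blinfun_eqI) (simp add: poly_op_pCons blinfun.add_left)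

lemma poly_op_X: "poly_op [:0, 1:] T = T"
  by (intro blinfun_eqI) (simp add: poly_op_pCons blinfun.add_left blinfun.add_right)

lemma poly_op_mult: "poly_op (p * q) T = poly_op p T o\<^sub>L poly_op q T"
proof (induction p)
  case (pCons a p)
  then show ?case
    by (intro blinfun_eqI)
       (simp add: poly_op_add poly_op_smult poly_op_pCons blinfun.add_left blinfun.scaleR_left)
qed simp

text \<open>The composition rule lets a polynomial of \<open>T\<^sup>2\<close> be read as a polynomial of \<open>T\<close>.\<close>

lemma poly_op_pcompose: "poly_op (pcompose p q) T = poly_op p (poly_op q T)"
  by (induction p) (simp_all add: pcompose_pCons poly_op_add poly_op_mult poly_op_pCons
      poly_op_const)

lemma poly_op_intertwine:
  assumes "\<And>x. blinfun_apply A (blinfun_apply S x) = blinfun_apply T (blinfun_apply A x)"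
  shows "blinfun_apply A (poly_op p S x) = poly_op p T (blinfun_apply A x)"
  by (induction p arbitrary: x)
     (simp_all add: poly_op_pCons blinfun.add_left blinfun.add_right
        blinfun.scaleR_left blinfun.scaleR_right assms)

lemma poly_op_commute: "blinfun_apply T (poly_op p T x) = poly_op p T (blinfun_apply T x)"
  by (rule poly_op_intertwine) simp

lemma clinear_op_poly_op:
  assumes "clinear_op T" shows "clinear_op (poly_op p T)"
proof (induction p)
  case (pCons a p)
  then show ?case using assms
    by (simp add: clinear_op_def poly_op_pCons blinfun.add_left blinfun.scaleR_left
        scaleC_add_right scaleC_of_real[symmetric] scaleC_scaleC mult.commute)
next
  case 0
  have "c *C (0::'a) = 0" for c
    using norm_scaleC[of c "0::'a"] by simp
  then show ?case by (simp add: clinear_op_def)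
qed

lemma self_adjoint_poly_op:
  assumes "self_adjoint T" shows "self_adjoint (poly_op p T)"
proof (induction p)
  case (pCons a p)
  have "cinner (T (poly_op p T x)) y = cinner x (T (poly_op p T y))" for x y
    by (simp only: self_adjointD[OF assms] self_adjointD[OF pCons.IH] poly_op_commute)
  then show ?case
    by (simp add: self_adjoint_def poly_op_pCons blinfun.add_left blinfun.scaleR_left cinner_simps)
qed (simp add: self_adjoint_def)

section \<open>The spectral bound for polynomials of a self-adjoint operator\<close>

definition bounded_below_op :: "('a::complex_hilbert \<Rightarrow>\<^sub>L 'a) \<Rightarrow> bool" where
  "bounded_below_op T \<longleftrightarrow> (\<exists>c>0. \<forall>x. c * norm x \<le> norm (blinfun_apply T x))"

text \<open>
  The real approximate point spectrum.  The norm of a self-adjoint operator is detected by vectors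
  that it almost annihilates after a shift, so this subset of the spectrum already controls all
  norms \<open>\<parallel>p(T)\<parallel>\<close>.
\<close>

definition approx_spectrum :: "('a::complex_hilbert \<Rightarrow>\<^sub>L 'a) \<Rightarrow> real set" where
  "approx_spectrum T = {t. \<not> bounded_below_op (T - t *\<^sub>R id_blinfun)}"

lemma bounded_below_op_compose:
  assumes "bounded_below_op S" "bounded_below_op T"
  shows "bounded_below_op (S o\<^sub>L T)"
proof -
  obtain c where c: "0 < c" "\<And>x. c * norm x \<le> norm (S x)"
    using assms(1) by (auto simp: bounded_below_op_def)
  obtain d where d: "0 < d" "\<And>x. d * norm x \<le> norm (T x)"
    using assms(2) by (auto simp: bounded_below_op_def)
  have "(c * d) * norm x \<le> norm (S (T x))" for x
  proof -
    have "c * (d * norm x) \<le> c * norm (T x)" using c(1) d(2) by (intro mult_left_mono) auto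
    also have "\<dots> \<le> norm (S (T x))" by (rule c(2))
    finally show ?thesis by (simp add: mult.assoc)
  qed
  then show ?thesis using c(1) d(1) by (auto simp: bounded_below_op_def intro!: exI[of _ "c * d"])
qed

lemma invertible_op_bounded_below:
  assumes "invertible_op T" shows "bounded_below_op T"
proof -
  obtain S where S: "S o\<^sub>L T = id_blinfun" using assms by (auto simp: invertible_op_def)
  have "inverse (norm S + 1) * norm x \<le> norm (T x)" for x
  proof -
    have "norm x = norm (S (T x))"
      using arg_cong[OF S, of "\<lambda>R. blinfun_apply R x"] by simp
    also have "\<dots> \<le> norm S * norm (T x)" by (rule norm_blinfun)
    also have "\<dots> \<le> (norm S + 1) * norm (T x)" by (intro mult_right_mono) auto
    finally show ?thesis by (simp add: field_simps add_pos_nonneg add_nonneg_pos)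
  qed
  moreover have "0 < inverse (norm S + 1)" by (simp add: add_nonneg_pos)
  ultimately show ?thesis unfolding bounded_below_op_def by blast
qed

lemma approx_spectrum_subset_spectrum:
  assumes "t \<in> approx_spectrum T" shows "complex_of_real t \<in> op_spectrum T"
proof -
  have "scalar_op (complex_of_real t) = t *\<^sub>R (id_blinfun :: 'a \<Rightarrow>\<^sub>L 'a)"
    by (intro blinfun_eqI) (simp add: scaleC_of_real blinfun.scaleR_left)
  then show ?thesis
    using assms invertible_op_bounded_below by (auto simp: approx_spectrum_def op_spectrum_def)
qed

lemma approx_spectrum_bounded:
  assumes "t \<in> approx_spectrum T" shows "\<bar>t\<bar> \<le> norm T"
proof (rule ccontr)
  assume t: "\<not> \<bar>t\<bar> \<le> norm T"
  have "(\<bar>t\<bar> - norm T) * norm x \<le> norm ((T - t *\<^sub>R id_blinfun) x)" for x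
  proof -
    have "norm (t *\<^sub>R x) - norm (T x) \<le> norm (t *\<^sub>R x - T x)" by (rule norm_triangle_ineq2)
    moreover have "norm (T x) \<le> norm T * norm x" by (rule norm_blinfun)
    ultimately show ?thesis
      by (simp add: blinfun.diff_left blinfun.scaleR_left norm_minus_commute algebra_simps)
  qed
  then show False
    using assms t by (auto simp: approx_spectrum_def bounded_below_op_def dest!: spec[of _ "\<bar>t\<bar> - norm T"])
qed

lemma approx_spectrum_nonneg:
  assumes T: "positive_op T" and t: "t \<in> approx_spectrum T" shows "0 \<le> t"
proof (rule ccontr)
  assume neg: "\<not> 0 \<le> t"
  have "- t * norm x \<le> norm ((T - t *\<^sub>R id_blinfun) x)" for x
  proof (cases "x = 0")
    case False
    have "- t * (norm x)\<^sup>2 \<le> Re (cinner (T x) x) - t * (norm x)\<^sup>2"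
      using T by (simp add: positive_op_def)
    also have "\<dots> = Re (cinner ((T - t *\<^sub>R id_blinfun) x) x)"
      by (simp add: blinfun.diff_left blinfun.scaleR_left cinner_simps Re_cinner_self)
    also have "\<dots> \<le> norm ((T - t *\<^sub>R id_blinfun) x) * norm x" by (rule Re_Cauchy_Schwarz)
    finally have "(- t * norm x) * norm x \<le> norm ((T - t *\<^sub>R id_blinfun) x) * norm x"
      by (simp add: power2_eq_square mult.assoc)
    then show ?thesis using False by (simp only: mult_le_cancel_right) auto
  qed simp
  then show False
    using t neg by (auto simp: approx_spectrum_def bounded_below_op_def dest!: spec[of _ "- t"])
qed

text \<open>
  A nonreal root \<open>z\<close> of a real polynomial comes with its conjugate; the remainder modulo
  \<open>(X - Re z)\<^sup>2 + (Im z)\<^sup>2\<close> is a real polynomial of degree at most 1 vanishing at \<open>z\<close>.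
\<close>

lemma real_poly_linear_or_quadratic_factor:
  fixes p :: "real poly"
  assumes "0 < degree p"
  obtains t where "[:- t, 1:] dvd p"
  | a b where "b \<noteq> 0" "[:a\<^sup>2 + b\<^sup>2, - 2 * a, 1:] dvd p"
proof -
  define E where "E p = poly (map_poly complex_of_real p)" for p
  have E_pCons: "E (pCons a p) z = complex_of_real a + z * E p z" for a p z
    by (simp add: E_def map_poly_pCons)
  have E_0: "E 0 z = 0" for z by (simp add: E_def)
  have E_add: "E (p + q) z = E p z + E q z" for p q z
    by (induction p q rule: poly_induct2) (simp_all add: E_0 E_pCons algebra_simps)
  have E_smult: "E (smult c p) z = complex_of_real c * E p z" for c p z
    by (induction p) (simp_all add: E_0 E_pCons algebra_simps)
  have E_mult: "E (p * q) z = E p z * E q z" for p q z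
    by (induction p) (simp_all add: E_0 E_pCons E_add E_smult algebra_simps)
  have "\<not> constant (E p)"
    using assms by (simp add: E_def constant_degree degree_map_poly)
  then obtain z where z: "E p z = 0"
    unfolding E_def using fundamental_theorem_of_algebra by blast
  show thesis
  proof (cases "Im z = 0")
    case True
    then have "z = complex_of_real (Re z)" by (simp add: complex_eq_iff)
    moreover have "E p (complex_of_real t) = complex_of_real (poly p t)" for t
      by (induction p) (simp_all add: E_0 E_pCons)
    ultimately have "poly p (Re z) = 0" using z of_real_eq_0_iff by metis
    then show thesis using that(1) poly_eq_0_iff_dvd by blast
  next
    case False
    let ?m = "[:(Re z)\<^sup>2 + (Im z)\<^sup>2, - 2 * Re z, 1:]"
    have "degree (p mod ?m) < 2"
      using degree_mod_less[of ?m p] by auto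
    then have "coeff (p mod ?m) (Suc (Suc n)) = 0" for n
      by (intro coeff_eq_0) simp
    then have "p mod ?m = [:coeff (p mod ?m) 0, coeff (p mod ?m) 1:]"
      by (intro poly_eqI) (simp add: coeff_pCons split: nat.split)
    then obtain c d where cd: "p mod ?m = [:c, d:]" by blast
    have "E ?m z = 0"
      by (simp add: E_pCons E_0 complex_eq_iff power2_eq_square algebra_simps)
    moreover have "E (?m * (p div ?m) + p mod ?m) z = E ?m z * E (p div ?m) z + E (p mod ?m) z"
      by (simp only: E_add E_mult)
    ultimately have "E (p mod ?m) z = 0"
      using z by (simp only: mult_div_mod_eq) simp
    then have "E [:c, d:] z = 0" by (simp only: cd)
    then have "c = 0" "d = 0" using False by (auto simp: E_pCons E_0 complex_eq_iff)
    then have "?m dvd p" using cd by (simp add: dvd_eq_mod_eq_0)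
    then show thesis using that(2) False by blast
  qed
qed

text \<open>
  Linear factors are bounded below off the spectrum, and a quadratic factor without real root
  is bounded below because \<open>\<langle>((T - a)\<^sup>2 + b\<^sup>2) x, x\<rangle> \<ge> b\<^sup>2 \<parallel>x\<parallel>\<^sup>2\<close>.
\<close>

lemma poly_op_bounded_below:
  assumes T: "self_adjoint T"
    and p: "p \<noteq> 0" and roots: "\<And>t. poly p t = 0 \<Longrightarrow> t \<notin> approx_spectrum T"
  shows "bounded_below_op (poly_op p T)"
  using p roots
proof (induction "degree p" arbitrary: p rule: less_induct)
  case less
  have step: "bounded_below_op (poly_op p T)"
    if m: "m dvd p" "0 < degree m" and bb: "bounded_below_op (poly_op m T)" for m
  proof -
    obtain q where q: "p = m * q" using m by blast
    have "m \<noteq> 0" "q \<noteq> 0" using less.prems(1) q by auto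
    then have "degree q < degree p" using m(2) by (simp add: q degree_mult_eq)
    then have "bounded_below_op (poly_op q T)"
      using less.hyps[of q] less.prems(2) \<open>q \<noteq> 0\<close> by (simp add: q)
    then show ?thesis using bb by (simp add: q poly_op_mult bounded_below_op_compose)
  qed
  show ?case
  proof (cases "degree p = 0")
    case True
    then obtain c where "p = [:c:]" by (rule degree_eq_zeroE)
    then show ?thesis using less.prems(1)
      by (auto simp: bounded_below_op_def poly_op_const blinfun.scaleR_left intro!: exI[of _ "\<bar>c\<bar>"])
  next
    case False
    then have "0 < degree p" by simp
    then show ?thesis
    proof (cases rule: real_poly_linear_or_quadratic_factor)
      case (1 t)
      then have "t \<notin> approx_spectrum T"
        using less.prems(2) poly_eq_0_iff_dvd by blast
      moreover have "poly_op [:- t, 1:] T = T - t *\<^sub>R id_blinfun"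
        by (intro blinfun_eqI) (simp add: poly_op_pCons blinfun.add_left blinfun.add_right
            blinfun.diff_left blinfun.scaleR_left)
      ultimately show ?thesis using 1 by (intro step) (auto simp: approx_spectrum_def)
    next
      case (2 a b)
      have "bounded_below_op (poly_op [:a\<^sup>2 + b\<^sup>2, - 2 * a, 1:] T)"
        unfolding bounded_below_op_def
      proof (intro exI[of _ "b\<^sup>2"] conjI allI)
        show "0 < b\<^sup>2" using 2 by simp
        fix x
        let ?y = "poly_op [:a\<^sup>2 + b\<^sup>2, - 2 * a, 1:] T x"
        show "b\<^sup>2 * norm x \<le> norm ?y"
        proof (cases "x = 0")
          case False
          have y: "?y = (a\<^sup>2 + b\<^sup>2) *\<^sub>R x - (2 * a) *\<^sub>R T x + T (T x)"
            by (simp add: poly_op_pCons blinfun.add_left blinfun.add_right blinfun.scaleR_left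
                blinfun.scaleR_right blinfun.diff_left blinfun.diff_right)
          have "Re (cinner ?y x) = (norm (T x - a *\<^sub>R x))\<^sup>2 + b\<^sup>2 * (norm x)\<^sup>2"
            unfolding y using self_adjointD[OF T, of "T x" x]
            by (simp add: norm_diff_sq cinner_simps Re_cinner_self power_mult_distrib algebra_simps)
          then have "b\<^sup>2 * (norm x)\<^sup>2 \<le> Re (cinner ?y x)" by simp
          also have "\<dots> \<le> norm ?y * norm x" by (rule Re_Cauchy_Schwarz)
          finally show ?thesis using False by (simp add: power2_eq_square)
        qed simp
      qed
      then show ?thesis by (intro step[OF 2(2)]) auto
    qed
  qed
qed

text \<open>
  For self-adjoint \<open>S\<close> with \<open>M = \<parallel>S\<parallel>\<close>, vectors almost attaining the norm are almost annihilated
  by \<open>M\<^sup>2 - S\<^sup>2\<close>, as \<open>\<parallel>(M\<^sup>2 - S\<^sup>2) x\<parallel>\<^sup>2 \<le> M\<^sup>2 (M\<^sup>2 \<parallel>x\<parallel>\<^sup>2 - \<parallel>S x\<parallel>\<^sup>2)\<close>.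
\<close>

lemma norm_sq_minus_sq_not_bounded_below:
  assumes S: "self_adjoint S" and "S \<noteq> 0"
  shows "\<not> bounded_below_op ((norm S)\<^sup>2 *\<^sub>R id_blinfun - (S o\<^sub>L S))"
proof
  let ?M = "norm S"
  have M: "0 < ?M" using assms by simp
  assume "bounded_below_op (?M\<^sup>2 *\<^sub>R id_blinfun - (S o\<^sub>L S))"
  then obtain c where c: "0 < c"
    and below: "\<And>x. c * norm x \<le> norm (?M\<^sup>2 *\<^sub>R x - S (S x))"
    by (auto simp: bounded_below_op_def blinfun.diff_left blinfun.scaleR_left)
  define d where "d = c\<^sup>2 / ?M\<^sup>2"
  have d: "0 < d" using c M by (simp add: d_def)
  have key: "(norm (S x))\<^sup>2 \<le> (?M\<^sup>2 - d) * (norm x)\<^sup>2" for x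
  proof -
    have "(c * norm x)\<^sup>2 \<le> (norm (?M\<^sup>2 *\<^sub>R x - S (S x)))\<^sup>2"
      using below c by (intro power_mono) auto
    also have "\<dots> = (?M\<^sup>2 * norm x)\<^sup>2 + (norm (S (S x)))\<^sup>2 - 2 * (?M\<^sup>2 * (norm (S x))\<^sup>2)"
      using self_adjointD[OF S, of x "S x"]
      by (simp add: norm_diff_sq cinner_simps power_mult_distrib Re_cinner_self
          flip: self_adjointD[OF S, of x "S x"])
    also have "(norm (S (S x)))\<^sup>2 \<le> (?M * norm (S x))\<^sup>2"
      by (intro power_mono norm_blinfun) simp
    finally have "c\<^sup>2 * (norm x)\<^sup>2 \<le> ?M\<^sup>2 * (?M\<^sup>2 * (norm x)\<^sup>2 - (norm (S x))\<^sup>2)"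
      by (simp add: power_mult_distrib algebra_simps power2_eq_square)
    then have "d * (norm x)\<^sup>2 \<le> ?M\<^sup>2 * (norm x)\<^sup>2 - (norm (S x))\<^sup>2"
      using M by (simp add: d_def field_simps)
    then show ?thesis by (simp add: algebra_simps)
  qed
  have "norm (S x) \<le> sqrt (max 0 (?M\<^sup>2 - d)) * norm x" for x
  proof (rule power2_le_imp_le)
    have "(norm (S x))\<^sup>2 \<le> max 0 (?M\<^sup>2 - d) * (norm x)\<^sup>2"
      using key[of x] by (rule order_trans) (intro mult_right_mono, auto)
    then show "(norm (S x))\<^sup>2 \<le> (sqrt (max 0 (?M\<^sup>2 - d)) * norm x)\<^sup>2"
      by (simp add: power_mult_distrib)
  qed simp
  then have "?M \<le> sqrt (max 0 (?M\<^sup>2 - d))"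
    by (intro norm_blinfun_bound) auto
  then have "?M\<^sup>2 \<le> (sqrt (max 0 (?M\<^sup>2 - d)))\<^sup>2"
    by (intro power_mono) auto
  then have "?M\<^sup>2 \<le> max 0 (?M\<^sup>2 - d)" by simp
  then show False using M d by (auto simp: max_def split: if_splits)
qed

text \<open>\<open>\<parallel>T\<parallel>\<^sup>2 - T\<^sup>2\<close> is not bounded below, so \<open>\<parallel>T\<parallel>\<close> or \<open>- \<parallel>T\<parallel>\<close> is a spectral point.\<close>

lemma approx_spectrum_nonempty:
  assumes T: "self_adjoint T" and x: "(x::'a::complex_hilbert) \<noteq> 0"
  shows "\<exists>t. t \<in> approx_spectrum (T :: 'a \<Rightarrow>\<^sub>L 'a)"
proof (cases "T = 0")
  case True
  have "\<not> bounded_below_op (0 :: 'a \<Rightarrow>\<^sub>L 'a)"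
  proof
    assume "bounded_below_op (0 :: 'a \<Rightarrow>\<^sub>L 'a)"
    then obtain c where "0 < c" "c * norm x \<le> 0" by (auto simp: bounded_below_op_def)
    then show False using x by (simp add: mult_le_0_iff)
  qed
  then show ?thesis by (intro exI[of _ 0]) (simp add: approx_spectrum_def True)
next
  case False
  let ?q = "[:(norm T)\<^sup>2:] - [:0, 1:] * [:0, 1:]"
  have "\<not> bounded_below_op (poly_op ?q T)"
    using norm_sq_minus_sq_not_bounded_below[OF T False]
    by (simp only: poly_op_diff poly_op_const poly_op_mult poly_op_X) simp
  moreover have "?q \<noteq> 0" by simp
  ultimately show ?thesis using poly_op_bounded_below[OF T] by blast
qed

text \<open>
  With \<open>M = \<parallel>p(T)\<parallel>\<close> the operator \<open>M\<^sup>2 - p(T)\<^sup>2\<close> is a polynomial of \<open>T\<close> that is not bounded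
  below, so one of the roots of \<open>M\<^sup>2 - p\<^sup>2\<close>, where \<open>p\<close> takes the value \<open>M\<close> or \<open>- M\<close>, is in the
  spectrum.  If \<open>M\<^sup>2 - p\<^sup>2\<close> is the zero polynomial, any point of the spectrum serves.
\<close>

lemma norm_poly_op_attained:
  assumes T: "self_adjoint T" and nz: "poly_op p T \<noteq> 0"
  obtains t where "t \<in> approx_spectrum T" "norm (poly_op p T) = \<bar>poly p t\<bar>"
proof -
  let ?M = "norm (poly_op p T)"
  let ?q = "[:?M\<^sup>2:] - p * p"
  have nbb: "\<not> bounded_below_op (poly_op ?q T)"
    using norm_sq_minus_sq_not_bounded_below[OF self_adjoint_poly_op[OF T] nz]
    by (simp add: poly_op_diff poly_op_const poly_op_mult)
  have "\<exists>t \<in> approx_spectrum T. poly ?q t = 0"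
  proof (cases "?q = 0")
    case True
    obtain x where "poly_op p T x \<noteq> 0"
      using nz blinfun_eqI[of "poly_op p T" 0] by auto
    then have "x \<noteq> 0" by auto
    then show ?thesis using approx_spectrum_nonempty[OF T] True by auto
  next
    case False
    then show ?thesis using poly_op_bounded_below[OF T False] nbb by blast
  qed
  then obtain t where t: "t \<in> approx_spectrum T" and "poly ?q t = 0" by blast
  then have "?M\<^sup>2 = \<bar>poly p t\<bar>\<^sup>2"
    using power2_eq_square[of "poly p t"] by simp
  then have "?M = \<bar>poly p t\<bar>" by (rule power2_eq_imp_eq) auto
  then show thesis using that t by blast
qed

lemma norm_poly_op_le:
  assumes "self_adjoint T" and "\<And>t. t \<in> approx_spectrum T \<Longrightarrow> \<bar>poly p t\<bar> \<le> M" and "0 \<le> M"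
  shows "norm (poly_op p T) \<le> M"
proof (cases "poly_op p T = 0")
  case False
  show ?thesis by (rule norm_poly_op_attained[OF assms(1) False]) (simp add: assms(2))
qed (use assms in simp)

text \<open>If \<open>0 \<le> p \<le> L\<close> on the spectrum then \<open>\<parallel>L/2 - p(T)\<parallel> \<le> L/2\<close>, whence \<open>p(T) \<ge> 0\<close>.\<close>

lemma poly_op_nonneg:
  assumes T: "self_adjoint T" and p: "\<And>t. t \<in> approx_spectrum T \<Longrightarrow> 0 \<le> poly p t"
  shows "0 \<le> Re (cinner (poly_op p T x) x)"
proof -
  have "compact (poly p ` {- norm T..norm T})"
    by (intro compact_continuous_image continuous_intros) auto
  then obtain L where "\<forall>t \<in> {- norm T..norm T}. \<bar>poly p t\<bar> \<le> L"
    using compact_imp_bounded by (force simp: bounded_iff)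
  then have L: "\<bar>poly p t\<bar> \<le> L" if "t \<in> {- norm T..norm T}" for t
    using that by blast
  have L0: "0 \<le> L" using L[of "norm T"] by simp
  let ?d = "[:L / 2:] - p"
  have "norm (poly_op ?d T) \<le> L / 2"
  proof (rule norm_poly_op_le[OF T])
    fix t assume t: "t \<in> approx_spectrum T"
    then have "\<bar>t\<bar> \<le> norm T" by (rule approx_spectrum_bounded)
    then have "\<bar>poly p t\<bar> \<le> L" by (intro L) auto
    then show "\<bar>poly ?d t\<bar> \<le> L / 2" using p[OF t] by (auto simp: abs_le_iff field_simps)
  qed (use L0 in simp)
  then have "norm (poly_op ?d T x) \<le> L / 2 * norm x"
    using norm_blinfun[of "poly_op ?d T" x] by (meson mult_right_mono norm_ge_zero order_trans)
  then have "norm (poly_op ?d T x) * norm x \<le> (L / 2 * norm x) * norm x"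
    by (rule mult_right_mono) simp
  then have "norm (poly_op ?d T x) * norm x \<le> L / 2 * (norm x)\<^sup>2"
    by (simp only: power2_eq_square mult.assoc)
  then have "Re (cinner (poly_op ?d T x) x) \<le> L / 2 * (norm x)\<^sup>2"
    using Re_Cauchy_Schwarz[of "poly_op ?d T x" x] by linarith
  then show ?thesis
    by (simp add: poly_op_diff poly_op_const blinfun.diff_left blinfun.scaleR_left cinner_simps
        Re_cinner_self)
qed

section \<open>Continuous functions of a positive operator\<close>

lemma polynomial_uniform_approximation:
  fixes f :: "real \<Rightarrow> real"
  assumes "continuous_on {a..b} f"
  obtains p :: "nat \<Rightarrow> real poly" where "uniform_limit {a..b} (\<lambda>n. poly (p n)) f sequentially"
proof -
  have "\<exists>p. \<forall>x \<in> {a..b}. \<bar>f x - poly p x\<bar> < 1 / (real n + 1)" for n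
  proof -
    have "0 < 1 / (real n + 1)" by simp
    then obtain g where g: "real_polynomial_function g"
      "\<And>x. x \<in> {a..b} \<Longrightarrow> \<bar>f x - g x\<bar> < 1 / (real n + 1)"
      using Stone_Weierstrass_real_polynomial_function[OF compact_Icc assms] by blast
    obtain c m where "g = (\<lambda>x. \<Sum>i\<le>m. c i * x ^ i)"
      using g(1) real_polynomial_function_iff_sum by blast
    then have "g x = poly (\<Sum>i\<le>m. monom (c i) i) x" for x
      by (simp add: poly_sum poly_monom)
    then show ?thesis using g(2) by metis
  qed
  then obtain p where p: "\<And>n x. x \<in> {a..b} \<Longrightarrow> \<bar>f x - poly (p n) x\<bar> < 1 / (real n + 1)"
    by metis
  have "uniform_limit {a..b} (\<lambda>n. poly (p n)) f sequentially"
  proof (rule uniform_limitI)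
    fix e :: real assume "0 < e"
    then obtain N where N: "1 / (real N + 1) < e"
      using reals_Archimedean[of e] by (auto simp: inverse_eq_divide add.commute)
    show "\<forall>\<^sub>F n in sequentially. \<forall>x \<in> {a..b}. dist (poly (p n) x) (f x) < e"
    proof (rule eventually_sequentiallyI[of N], intro ballI)
      fix n x assume n: "N \<le> n" and x: "x \<in> {a..b}"
      have "1 / (real n + 1) \<le> 1 / (real N + 1)" using n by (intro divide_left_mono) auto
      then show "dist (poly (p n) x) (f x) < e"
        using p[OF x, of n] N by (simp add: dist_real_def abs_minus_commute)
    qed
  qed
  then show thesis by (rule that)
qed

text \<open>
  The spectral bound turns uniform convergence of polynomials on the spectrum into norm convergence
  of operators; the next lemmas are the resulting uniqueness and existence of limits.
\<close>

lemma tendsto_poly_op_zero: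
  assumes T: "self_adjoint T"
    and d: "uniform_limit (approx_spectrum T) (\<lambda>n. poly (d n)) (\<lambda>_. 0) sequentially"
  shows "(\<lambda>n. poly_op (d n) T) \<longlonglongrightarrow> 0"
proof (rule tendstoI)
  fix e :: real assume e: "0 < e"
  have "\<forall>\<^sub>F n in sequentially. \<forall>t \<in> approx_spectrum T. dist (poly (d n) t) 0 < e / 2"
    using uniform_limitD[OF d, of "e / 2"] e by simp
  then show "\<forall>\<^sub>F n in sequentially. dist (poly_op (d n) T) 0 < e"
  proof eventually_elim
    case (elim n)
    then have "norm (poly_op (d n) T) \<le> e / 2"
      using e by (intro norm_poly_op_le[OF T]) (auto intro: less_imp_le)
    then show ?case using e by simp
  qed
qed

lemma poly_op_limit_unique:
  assumes T: "self_adjoint T"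
    and p: "uniform_limit (approx_spectrum T) (\<lambda>n. poly (p n)) f sequentially"
    and q: "uniform_limit (approx_spectrum T) (\<lambda>n. poly (q n)) f sequentially"
    and S: "(\<lambda>n. poly_op (p n) T) \<longlonglongrightarrow> S"
  shows "(\<lambda>n. poly_op (q n) T) \<longlonglongrightarrow> S"
proof -
  have "poly (q n - p n) = (\<lambda>t. poly (q n) t - poly (p n) t)" for n
    by (rule ext) (rule poly_diff)
  then have "uniform_limit (approx_spectrum T) (\<lambda>n. poly (q n - p n)) (\<lambda>_. 0) sequentially"
    using uniform_limit_minus[OF q p] by simp
  then have "(\<lambda>n. poly_op (q n - p n) T) \<longlonglongrightarrow> 0" by (rule tendsto_poly_op_zero[OF T])
  from tendsto_add[OF this S] show ?thesis by (simp add: poly_op_diff)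
qed

lemma tendsto_poly_op:
  assumes T: "self_adjoint T"
    and p: "uniform_limit (approx_spectrum T) (\<lambda>n. poly (p n)) f sequentially"
    and q: "\<And>t. t \<in> approx_spectrum T \<Longrightarrow> f t = poly q t"
  shows "(\<lambda>n. poly_op (p n) T) \<longlonglongrightarrow> poly_op q T"
proof (rule poly_op_limit_unique[OF T _ p tendsto_const])
  show "uniform_limit (approx_spectrum T) (\<lambda>n::nat. poly q) f sequentially"
    using q by (auto intro!: uniform_limitI always_eventually)
qed

lemma uniform_limit_poly_mult:
  fixes f g :: "real \<Rightarrow> real"
  assumes p: "uniform_limit {a..b} (\<lambda>n. poly (p n)) f F" and f: "continuous_on {a..b} f"
    and q: "uniform_limit {a..b} (\<lambda>n. poly (q n)) g F" and g: "continuous_on {a..b} g"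
  shows "uniform_limit {a..b} (\<lambda>n. poly (p n * q n)) (\<lambda>t. f t * g t) F"
proof -
  have "poly (p n * q n) = (\<lambda>t. poly (p n) t * poly (q n) t)" for n
    by (rule ext) (rule poly_mult)
  then show ?thesis
    using uniform_lim_mult[OF p q compact_imp_bounded[OF compact_continuous_image[OF f]]
        compact_imp_bounded[OF compact_continuous_image[OF g]]] by simp
qed

lemma poly_op_convergent:
  assumes T: "self_adjoint T"
    and p: "uniform_limit (approx_spectrum T) (\<lambda>n. poly (p n)) f sequentially"
  obtains S where "(\<lambda>n. poly_op (p n) T) \<longlonglongrightarrow> S"
proof -
  have "Cauchy (\<lambda>n. poly_op (p n) T)"
  proof (rule metric_CauchyI)
    fix e :: real assume e: "0 < e"
    have "\<forall>\<^sub>F n in sequentially. \<forall>t \<in> approx_spectrum T. dist (poly (p n) t) (f t) < e / 4"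
      using uniform_limitD[OF p, of "e / 4"] e by simp
    then obtain N where
      N: "\<And>n t. N \<le> n \<Longrightarrow> t \<in> approx_spectrum T \<Longrightarrow> dist (poly (p n) t) (f t) < e / 4"
      by (auto simp: eventually_sequentially)
    show "\<exists>M. \<forall>i\<ge>M. \<forall>j\<ge>M. dist (poly_op (p i) T) (poly_op (p j) T) < e"
    proof (intro exI[of _ N] allI impI)
      fix i j assume ij: "N \<le> i" "N \<le> j"
      have "norm (poly_op (p i - p j) T) \<le> e / 2"
      proof (rule norm_poly_op_le[OF T])
        fix t assume t: "t \<in> approx_spectrum T"
        have "dist (poly (p i) t) (poly (p j) t)
            \<le> dist (poly (p i) t) (f t) + dist (poly (p j) t) (f t)"
          by (rule dist_triangle2)
        also have "\<dots> \<le> e / 4 + e / 4"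
          using N[OF ij(1) t] N[OF ij(2) t] by (intro add_mono) auto
        finally show "\<bar>poly (p i - p j) t\<bar> \<le> e / 2" by (simp add: dist_real_def)
      qed (use e in simp)
      then show "dist (poly_op (p i) T) (poly_op (p j) T) < e"
        using e by (simp add: dist_norm poly_op_diff)
    qed
  qed
  then show thesis using that Cauchy_convergent convergent_def by blast
qed

lemma approx_spectrum_positive:
  assumes "positive_op T" shows "approx_spectrum T \<subseteq> {0..norm T}"
  using approx_spectrum_nonneg[OF assms] approx_spectrum_bounded[of _ T] by force

lemmas tendsto_blinfun_compose =
  bounded_bilinear.tendsto[OF bounded_bilinear_blinfun_compose]

lemma tendsto_blinfun_apply: "S \<longlonglongrightarrow> T \<Longrightarrow> (\<lambda>n. blinfun_apply (S n) x) \<longlonglongrightarrow> blinfun_apply T x"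
  by (intro tendsto_intros)

lemma clinear_op_limit:
  assumes "\<And>n. clinear_op (S n)" and "S \<longlonglongrightarrow> T"
  shows "clinear_op T"
  unfolding clinear_op_def
proof (intro allI)
  fix c x
  have "(\<lambda>n. scalar_op c (S n x)) \<longlonglongrightarrow> scalar_op c (T x)"
    by (intro tendsto_intros assms(2))
  then have "(\<lambda>n. S n (c *C x)) \<longlonglongrightarrow> c *C T x"
    using assms(1) by (simp add: clinear_op_def)
  then show "T (c *C x) = c *C T x"
    using tendsto_blinfun_apply[OF assms(2)] LIMSEQ_unique by blast
qed

lemma self_adjoint_limit:
  assumes "\<And>n. self_adjoint (S n)" and S: "S \<longlonglongrightarrow> T"
  shows "self_adjoint T"
  unfolding self_adjoint_def
proof (intro allI)
  fix x y
  have "(\<lambda>n. cinner (S n x) y) \<longlonglongrightarrow> cinner (T x) y"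
    by (intro tendsto_intros S)
  moreover have "(\<lambda>n. cinner (S n x) y) \<longlonglongrightarrow> cinner x (T y)"
    using assms(1) by (simp add: self_adjoint_def) (intro tendsto_intros S)
  ultimately show "cinner (T x) y = cinner x (T y)" by (rule LIMSEQ_unique)
qed

lemma positive_op_clinear: "positive_op T \<Longrightarrow> clinear_op T"
  by (simp add: positive_op_def)

text \<open>
  For \<open>t\<close> outside \<open>{0..\<parallel>T\<parallel>}\<close> polynomial approximations of \<open>1 / (u - t)\<close> converge to an inverse
  of \<open>T - t\<close>.
\<close>

lemma real_spectrum_positive:
  assumes T: "positive_op T" and t: "complex_of_real t \<in> op_spectrum T"
  shows "t \<in> {0..norm T}"
proof (rule ccontr)
  let ?I = "{0..norm T}"
  assume out: "t \<notin> ?I"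
  have sa: "self_adjoint T" using T by (rule positive_op_self_adjoint)
  have sub: "approx_spectrum T \<subseteq> ?I" using T by (rule approx_spectrum_positive)
  have cont: "continuous_on ?I (\<lambda>u. 1 / (u - t))"
    using out by (auto intro!: continuous_intros)
  then obtain p where p: "uniform_limit ?I (\<lambda>n. poly (p n)) (\<lambda>u. 1 / (u - t)) sequentially"
    by (rule polynomial_uniform_approximation)
  obtain S where S: "(\<lambda>n. poly_op (p n) T) \<longlonglongrightarrow> S"
    using poly_op_convergent[OF sa uniform_limit_on_subset[OF p sub]] by blast
  let ?l = "[:- t, 1:]"
  have "uniform_limit ?I (\<lambda>n. poly (?l * p n)) (\<lambda>u. poly ?l u * (1 / (u - t))) sequentially"
    by (intro uniform_limit_poly_mult p uniform_limit_const cont continuous_on_poly continuous_on_id)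
  then have "uniform_limit (approx_spectrum T) (\<lambda>n. poly (?l * p n))
      (\<lambda>u. poly ?l u * (1 / (u - t))) sequentially"
    using sub by (rule uniform_limit_on_subset)
  then have "(\<lambda>n. poly_op (?l * p n) T) \<longlonglongrightarrow> poly_op [:1:] T"
    by (rule tendsto_poly_op[OF sa]) (use out sub in auto)
  then have one: "(\<lambda>n. poly_op (?l * p n) T) \<longlonglongrightarrow> id_blinfun"
    by (simp only: poly_op_const) simp
  have l: "poly_op ?l T = T - scalar_op (complex_of_real t)"
    by (intro blinfun_eqI) (simp add: poly_op_pCons blinfun.add_left blinfun.add_right
        blinfun.diff_left blinfun.scaleR_left scaleC_of_real)
  have "(\<lambda>n. poly_op (?l * p n) T) \<longlonglongrightarrow> (poly_op ?l T o\<^sub>L S)"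
    unfolding poly_op_mult by (intro tendsto_blinfun_compose tendsto_const S)
  then have "poly_op ?l T o\<^sub>L S = id_blinfun" using one LIMSEQ_unique by blast
  moreover have "(\<lambda>n. poly_op (?l * p n) T) \<longlonglongrightarrow> (S o\<^sub>L poly_op ?l T)"
    unfolding mult.commute[of ?l] poly_op_mult by (intro tendsto_blinfun_compose tendsto_const S)
  then have "S o\<^sub>L poly_op ?l T = id_blinfun" using one LIMSEQ_unique by blast
  moreover have "clinear_op S"
    using clinear_op_limit[OF clinear_op_poly_op S] T by (auto simp: positive_op_def)
  ultimately show False using t unfolding l op_spectrum_def invertible_op_def by blast
qed

text \<open>
  The real spectrum lies between the approximate spectrum and \<open>{0..\<parallel>T\<parallel>}\<close>.  The upper inclusion
  makes approximations on the interval admissible in the definition of the functional calculus, and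
  the lower one makes the limit independent of their choice.
\<close>

lemma tendsto_fun_calc:
  assumes T: "positive_op T"
    and p: "uniform_limit {0..norm T} (\<lambda>n. poly (p n)) f sequentially"
  shows "(\<lambda>n. poly_op (p n) T) \<longlonglongrightarrow> fun_calc f T"
proof -
  have sa: "self_adjoint T" using T by (rule positive_op_self_adjoint)
  let ?\<sigma> = "{t. complex_of_real t \<in> op_spectrum T}"
  have 1: "?\<sigma> \<subseteq> {0..norm T}" using real_spectrum_positive[OF T] by blast
  have 2: "approx_spectrum T \<subseteq> ?\<sigma>" using approx_spectrum_subset_spectrum by blast
  note p\<sigma> = uniform_limit_on_subset[OF p 1]
  note pa = uniform_limit_on_subset[OF p\<sigma> 2]
  obtain S where S: "(\<lambda>n. poly_op (p n) T) \<longlonglongrightarrow> S"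
    using poly_op_convergent[OF sa pa] by blast
  have "fun_calc f T = S"
    unfolding fun_calc_def
  proof (rule the_equality)
    show "\<exists>p. uniform_limit ?\<sigma> (\<lambda>n. poly (p n)) f sequentially \<and> (\<lambda>n. poly_op (p n) T) \<longlonglongrightarrow> S"
      using p\<sigma> S by blast
    fix R assume "\<exists>q. uniform_limit ?\<sigma> (\<lambda>n. poly (q n)) f sequentially \<and> (\<lambda>n. poly_op (q n) T) \<longlonglongrightarrow> R"
    then obtain q where q: "uniform_limit ?\<sigma> (\<lambda>n. poly (q n)) f sequentially"
      and R: "(\<lambda>n. poly_op (q n) T) \<longlonglongrightarrow> R" by blast
    have "(\<lambda>n. poly_op (q n) T) \<longlonglongrightarrow> S"
      by (rule poly_op_limit_unique[OF sa pa uniform_limit_on_subset[OF q 2] S])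
    then show "R = S" using R LIMSEQ_unique by blast
  qed
  then show ?thesis using S by simp
qed

text \<open>
  Order is preserved by passing to limits: \<open>p\<^sub>n - q + \<epsilon>\<close> is eventually nonnegative on the spectrum.
\<close>

lemma poly_op_limit_ge:
  assumes T: "self_adjoint T"
    and p: "uniform_limit (approx_spectrum T) (\<lambda>n. poly (p n)) f sequentially"
    and S: "(\<lambda>n. poly_op (p n) T) \<longlonglongrightarrow> S"
    and q: "\<And>t. t \<in> approx_spectrum T \<Longrightarrow> poly q t \<le> f t"
  shows "Re (cinner (poly_op q T x) x) \<le> Re (cinner (S x) x)"
proof -
  have lim: "(\<lambda>n. Re (cinner (poly_op (p n) T x) x)) \<longlonglongrightarrow> Re (cinner (S x) x)"
    by (intro tendsto_intros S)
  have e: "Re (cinner (poly_op q T x) x) - e * (norm x)\<^sup>2 \<le> Re (cinner (S x) x)" if "0 < e" for e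
  proof (rule tendsto_lowerbound[OF lim])
    show "\<forall>\<^sub>F n in sequentially. Re (cinner (poly_op q T x) x) - e * (norm x)\<^sup>2
        \<le> Re (cinner (poly_op (p n) T x) x)"
      using uniform_limitD[OF p \<open>0 < e\<close>]
    proof eventually_elim
      case (elim n)
      have "0 \<le> poly (p n - q + [:e:]) t" if "t \<in> approx_spectrum T" for t
        using elim that q[OF that] by (force simp: dist_real_def)
      then have "0 \<le> Re (cinner (poly_op (p n - q + [:e:]) T x) x)"
        by (intro poly_op_nonneg[OF T])
      then show ?case
        by (simp add: poly_op_add poly_op_diff poly_op_const blinfun.diff_left blinfun.add_left
            blinfun.scaleR_left cinner_simps Re_cinner_self)
    qed
  qed simp
  show ?thesis
  proof (rule field_le_epsilon)
    fix d :: real assume d: "0 < d"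
    \<comment> \<open>\<open>N\<close> exceeds \<open>\<parallel>x\<parallel>\<^sup>2\<close> and is nonzero even for \<open>x = 0\<close>\<close>
    let ?N = "(norm x)\<^sup>2 + 1"
    have N: "0 < ?N" by (simp add: add_nonneg_pos)
    have "d / ?N * (norm x)\<^sup>2 \<le> d" using d N by (simp add: field_simps)
    then show "Re (cinner (poly_op q T x) x) \<le> Re (cinner (S x) x) + d"
      using e[of "d / ?N"] d N by simp
  qed
qed

section \<open>Powers of a positive operator\<close>

lemma powr_op_approximation:
  assumes "positive_op T" and "0 < s"
  obtains p where "uniform_limit {0..norm T} (\<lambda>n. poly (p n)) (\<lambda>t. t powr s) sequentially"
    and "(\<lambda>n. poly_op (p n) T) \<longlonglongrightarrow> powr_op T s"
proof -
  have "continuous_on {0..norm T} (\<lambda>t. t powr s)"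
    using assms(2) by (intro continuous_on_powr' continuous_intros) auto
  then obtain p where p: "uniform_limit {0..norm T} (\<lambda>n. poly (p n)) (\<lambda>t. t powr s) sequentially"
    by (rule polynomial_uniform_approximation)
  from that[OF p tendsto_fun_calc[OF assms(1) p, folded powr_op_def]] show thesis .
qed

lemma self_adjoint_powr_op:
  assumes "positive_op T" and "0 < s" shows "self_adjoint (powr_op T s)"
proof -
  obtain p where "(\<lambda>n. poly_op (p n) T) \<longlonglongrightarrow> powr_op T s"
    using powr_op_approximation[OF assms] by blast
  then show ?thesis
    by (rule self_adjoint_limit[OF self_adjoint_poly_op[OF positive_op_self_adjoint[OF assms(1)]]])
qed

text \<open>
  The minorants \<open>q\<close> of interest are tangents; this is how scalar convexity passes to operators.
\<close>

lemma powr_op_ge: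
  assumes T: "positive_op T" and s: "0 < s"
    and q: "\<And>t. 0 \<le> t \<Longrightarrow> poly q t \<le> t powr s"
  shows "Re (cinner (poly_op q T x) x) \<le> Re (cinner (powr_op T s x) x)"
proof -
  obtain p where p: "uniform_limit {0..norm T} (\<lambda>n. poly (p n)) (\<lambda>t. t powr s) sequentially"
    and lim: "(\<lambda>n. poly_op (p n) T) \<longlonglongrightarrow> powr_op T s"
    using powr_op_approximation[OF T s] by blast
  show ?thesis
    by (rule poly_op_limit_ge[OF positive_op_self_adjoint[OF T]
          uniform_limit_on_subset[OF p approx_spectrum_positive[OF T]] lim])
       (use q approx_spectrum_nonneg[OF T] in auto)
qed

lemma powr_op_nonneg:
  assumes "positive_op T" and "0 < s"
  shows "0 \<le> Re (cinner (powr_op T s x) x)"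
  using powr_op_ge[OF assms, of 0 x] by simp

lemma powr_op_double:
  assumes T: "positive_op T" and s: "0 < s"
  shows "powr_op T s o\<^sub>L powr_op T s = powr_op T (2 * s)"
proof -
  let ?f = "\<lambda>t::real. t powr s"
  obtain p where p: "uniform_limit {0..norm T} (\<lambda>n. poly (p n)) ?f sequentially"
    and lim: "(\<lambda>n. poly_op (p n) T) \<longlonglongrightarrow> powr_op T s"
    using powr_op_approximation[OF T s] by blast
  have "continuous_on {0..norm T} ?f"
    using s by (intro continuous_on_powr' continuous_intros) auto
  then have "uniform_limit {0..norm T} (\<lambda>n. poly (p n * p n)) (\<lambda>t. ?f t * ?f t) sequentially"
    by (intro uniform_limit_poly_mult p)
  then have "uniform_limit {0..norm T} (\<lambda>n. poly (p n * p n)) (\<lambda>t. t powr (2 * s)) sequentially"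
    by (simp add: powr_add[symmetric])
  then have "(\<lambda>n. poly_op (p n * p n) T) \<longlonglongrightarrow> powr_op T (2 * s)"
    unfolding powr_op_def by (rule tendsto_fun_calc[OF T])
  moreover have "(\<lambda>n. poly_op (p n * p n) T) \<longlonglongrightarrow> (powr_op T s o\<^sub>L powr_op T s)"
    unfolding poly_op_mult by (intro tendsto_blinfun_compose lim)
  ultimately show ?thesis using LIMSEQ_unique by blast
qed

section \<open>The absolute value of an operator\<close>

lemma sqrt_approximation:
  obtains q where "uniform_limit {0..K} (\<lambda>n. poly (q n)) sqrt sequentially"
  using polynomial_uniform_approximation[of 0 K sqrt] continuous_on_real_sqrt[OF continuous_on_id]
  by blast

text \<open>
  If \<open>q\<^sub>n \<rightarrow> sqrt\<close> then \<open>q\<^sub>n (t\<^sup>2) \<rightarrow> \<bar>t\<bar>\<close>; this turns polynomials of \<open>T\<^sup>2\<close> into approximations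
  of the absolute value of the self-adjoint operator \<open>T\<close>.
\<close>

lemma uniform_limit_sqrt_square:
  assumes q: "uniform_limit {0..K} (\<lambda>n. poly (q n)) sqrt sequentially"
    and A: "\<And>t. t \<in> A \<Longrightarrow> \<bar>t\<bar> \<le> b" and b: "b\<^sup>2 \<le> K"
  shows "uniform_limit A (\<lambda>n. poly (pcompose (q n) ([:0, 1:] * [:0, 1:]))) (\<lambda>t. \<bar>t\<bar>) sequentially"
proof (rule uniform_limitI)
  fix e :: real assume "0 < e"
  have sq: "t * t \<in> {0..K}" if "t \<in> A" for t
  proof -
    have "\<bar>t\<bar>\<^sup>2 \<le> b\<^sup>2" using A[OF that] by (intro power_mono) auto
    then show ?thesis using b by (simp add: power2_eq_square)
  qed
  show "\<forall>\<^sub>F n in sequentially. \<forall>t \<in> A. dist (poly (pcompose (q n) ([:0, 1:] * [:0, 1:])) t) \<bar>t\<bar> < e"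
    using uniform_limitD[OF q \<open>0 < e\<close>]
  proof eventually_elim
    case (elim n)
    show ?case
    proof
      fix t assume "t \<in> A"
      then have "dist (poly (q n) (t * t)) (sqrt (t * t)) < e" using elim sq by blast
      then show "dist (poly (pcompose (q n) ([:0, 1:] * [:0, 1:])) t) \<bar>t\<bar> < e"
        by (simp add: poly_pcompose)
    qed
  qed
qed

lemma poly_op_pcompose_square:
  "poly_op (pcompose q ([:0, 1:] * [:0, 1:])) T = poly_op q (T o\<^sub>L T)"
  by (simp only: poly_op_pcompose poly_op_mult poly_op_X)

text \<open>A positive square root is a limit of polynomials of the square; hence it is unique.\<close>

lemma positive_root_limit:
  assumes P: "positive_op P" and q: "uniform_limit {0..K} (\<lambda>n. poly (q n)) sqrt sequentially"
    and K: "(norm P)\<^sup>2 \<le> K"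
  shows "(\<lambda>n. poly_op (q n) (P o\<^sub>L P)) \<longlonglongrightarrow> P"
proof -
  let ?d = "\<lambda>n. pcompose (q n) ([:0, 1:] * [:0, 1:])"
  have "uniform_limit (approx_spectrum P) (\<lambda>n. poly (?d n)) (\<lambda>t. \<bar>t\<bar>) sequentially"
    using q approx_spectrum_bounded K by (rule uniform_limit_sqrt_square)
  then have "(\<lambda>n. poly_op (?d n) P) \<longlonglongrightarrow> poly_op [:0, 1:] P"
    by (rule tendsto_poly_op[OF positive_op_self_adjoint[OF P]]) (simp add: approx_spectrum_nonneg[OF P])
  then show ?thesis by (simp only: poly_op_pcompose_square poly_op_X)
qed

lemma positive_root_unique:
  assumes "positive_op P" "positive_op Q" "P o\<^sub>L P = Q o\<^sub>L Q"
  shows "P = Q"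
proof -
  let ?K = "max ((norm P)\<^sup>2) ((norm Q)\<^sup>2)"
  obtain q where q: "uniform_limit {0..?K} (\<lambda>n. poly (q n)) sqrt sequentially"
    by (rule sqrt_approximation)
  have "(\<lambda>n. poly_op (q n) (P o\<^sub>L P)) \<longlonglongrightarrow> P"
    by (rule positive_root_limit[OF assms(1) q]) simp
  moreover have "(\<lambda>n. poly_op (q n) (Q o\<^sub>L Q)) \<longlonglongrightarrow> Q"
    by (rule positive_root_limit[OF assms(2) q]) simp
  ultimately show ?thesis using assms(3) LIMSEQ_unique by metis
qed

lemma self_adjoint_cinner_real: "self_adjoint T \<Longrightarrow> cinner (blinfun_apply T x) x \<in> \<real>"
  using cinner_commute[of "T x" x] by (simp add: self_adjointD Reals_cnj_iff)

text \<open>The limit of \<open>q\<^sub>n(C)\<close> for polynomials \<open>q\<^sub>n \<rightarrow> sqrt\<close> is a positive square root of \<open>C\<close>.\<close>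

lemma positive_root_exists:
  assumes C: "positive_op C"
  obtains P where "positive_op P" "P o\<^sub>L P = C"
proof -
  have sa: "self_adjoint C" using C by (rule positive_op_self_adjoint)
  have sub: "approx_spectrum C \<subseteq> {0..norm C}" using C by (rule approx_spectrum_positive)
  obtain q where q: "uniform_limit {0..norm C} (\<lambda>n. poly (q n)) sqrt sequentially"
    by (rule sqrt_approximation)
  note qa = uniform_limit_on_subset[OF q sub]
  obtain P where P: "(\<lambda>n. poly_op (q n) C) \<longlonglongrightarrow> P"
    using poly_op_convergent[OF sa qa] by blast
  have "0 \<le> Re (cinner (P x) x)" for x
    using poly_op_limit_ge[OF sa qa P, of 0 x] approx_spectrum_nonneg[OF C] by simp
  moreover have "self_adjoint P" by (rule self_adjoint_limit[OF self_adjoint_poly_op[OF sa] P])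
  moreover have "clinear_op P"
    by (rule clinear_op_limit[OF clinear_op_poly_op[OF positive_op_clinear[OF C]] P])
  ultimately have pos: "positive_op P"
    by (simp add: positive_op_def self_adjoint_cinner_real)
  have "uniform_limit {0..norm C} (\<lambda>n. poly (q n * q n)) (\<lambda>t. sqrt t * sqrt t) sequentially"
    by (intro uniform_limit_poly_mult q continuous_intros)
  then have "uniform_limit (approx_spectrum C) (\<lambda>n. poly (q n * q n)) (\<lambda>t. sqrt t * sqrt t) sequentially"
    using sub by (rule uniform_limit_on_subset)
  then have "(\<lambda>n. poly_op (q n * q n) C) \<longlonglongrightarrow> poly_op [:0, 1:] C"
    by (rule tendsto_poly_op[OF sa]) (simp add: approx_spectrum_nonneg[OF C])
  then have "(\<lambda>n. poly_op (q n * q n) C) \<longlonglongrightarrow> C"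
    by (simp only: poly_op_X)
  moreover have "(\<lambda>n. poly_op (q n * q n) C) \<longlonglongrightarrow> (P o\<^sub>L P)"
    unfolding poly_op_mult by (intro tendsto_blinfun_compose P)
  ultimately have "P o\<^sub>L P = C" using LIMSEQ_unique by blast
  then show thesis using that pos by blast
qed

lemma
  assumes "clinear_op A"
  shows positive_op_abs_op: "positive_op (abs_op A)"
    and abs_op_square: "abs_op A o\<^sub>L abs_op A = adj A o\<^sub>L A"
proof -
  obtain P where P: "positive_op P" "P o\<^sub>L P = adj A o\<^sub>L A"
    using positive_root_exists[OF positive_op_adj_compose[OF assms]] by blast
  have "abs_op A = P"
    unfolding abs_op_def
    by (rule the_equality) (use P positive_root_unique in metis)+
  then show "positive_op (abs_op A)" "abs_op A o\<^sub>L abs_op A = adj A o\<^sub>L A"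
    using P by auto
qed

lemma norm_abs_op:
  assumes "clinear_op A"
  shows "(norm (blinfun_apply A x))\<^sup>2 = Re (cinner ((abs_op A o\<^sub>L abs_op A) x) x)"
  by (simp add: abs_op_square[OF assms] cinner_adj_left[OF assms] Re_cinner_self)

text \<open>
  The self-adjoint operator \<open>J (x, y) = (A\<^sup>* y, A x)\<close> has \<open>J\<^sup>2 = A\<^sup>*A \<oplus> A A\<^sup>*\<close>, so
  \<open>\<bar>J\<bar> = \<bar>A\<bar> \<oplus> \<bar>A\<^sup>*\<bar>\<close>, and \<open>J \<le> \<bar>J\<bar>\<close> because \<open>t \<le> \<bar>t\<bar>\<close> on the spectrum.  This replaces the polar
  decomposition.
\<close>

lemma mixed_arithmetic_mean:
  assumes A: "clinear_op A"
  shows "2 * Re (cinner (blinfun_apply A x) y)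
    \<le> Re (cinner (abs_op A x) x) + Re (cinner (abs_op (adj A) y) y)"
proof -
  let ?J = "antidiag_op (adj A) A"
  let ?P = "abs_op A" and ?Q = "abs_op (adj A)"
  have P: "positive_op ?P" "?P o\<^sub>L ?P = adj A o\<^sub>L A"
    using A by (rule positive_op_abs_op, rule abs_op_square)
  have Q: "positive_op ?Q" "?Q o\<^sub>L ?Q = A o\<^sub>L adj A"
    using positive_op_abs_op[OF clinear_op_adj[OF A]] abs_op_square[OF clinear_op_adj[OF A]]
    by (simp_all add: adj_adj[OF A])
  have J: "self_adjoint ?J"
    unfolding self_adjoint_def
    by (simp add: split_paired_all cinner_prod_def cinner_adj_left[OF A] cinner_adj_right[OF A] add.commute)
  let ?K = "max ((norm ?J)\<^sup>2) (max ((norm ?P)\<^sup>2) ((norm ?Q)\<^sup>2))"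
  obtain q where q: "uniform_limit {0..?K} (\<lambda>n. poly (q n)) sqrt sequentially"
    by (rule sqrt_approximation)
  let ?d = "\<lambda>n. pcompose (q n) ([:0, 1:] * [:0, 1:])"
  have d: "uniform_limit (approx_spectrum ?J) (\<lambda>n. poly (?d n)) (\<lambda>t. \<bar>t\<bar>) sequentially"
    using q approx_spectrum_bounded by (rule uniform_limit_sqrt_square) auto
  obtain S where S: "(\<lambda>n. poly_op (?d n) ?J) \<longlonglongrightarrow> S"
    using poly_op_convergent[OF J d] by blast
  have "Re (cinner (?J (x, y)) (x, y)) \<le> Re (cinner (S (x, y)) (x, y))"
    using poly_op_limit_ge[OF J d S, of "[:0, 1:]" "(x, y)"] by (simp add: poly_op_X)
  moreover have "Re (cinner (?J (x, y)) (x, y)) = 2 * Re (cinner (A x) y)"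
    using Re_cinner_commute[of y "A x"] by (simp add: cinner_prod_def cinner_adj_left[OF A])
  moreover have "Re (cinner (S (x, y)) (x, y)) = Re (cinner (?P x) x) + Re (cinner (?Q y) y)"
  proof (rule LIMSEQ_unique)
    show "(\<lambda>n. Re (cinner (poly_op (?d n) ?J (x, y)) (x, y))) \<longlonglongrightarrow> Re (cinner (S (x, y)) (x, y))"
      by (intro tendsto_intros S)
    have "fst_blinfun ((?J o\<^sub>L ?J) z) = (?P o\<^sub>L ?P) (fst_blinfun z)" for z
      unfolding P(2) by (cases z) (simp add: fst_blinfun.rep_eq)
    then have 1: "fst (poly_op (q n) (?J o\<^sub>L ?J) z) = poly_op (q n) (?P o\<^sub>L ?P) (fst z)" for n z
      using poly_op_intertwine[of fst_blinfun "?J o\<^sub>L ?J" "?P o\<^sub>L ?P" "q n" z]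
      by (simp add: fst_blinfun.rep_eq)
    have "snd_blinfun ((?J o\<^sub>L ?J) z) = (?Q o\<^sub>L ?Q) (snd_blinfun z)" for z
      unfolding Q(2) by (cases z) (simp add: snd_blinfun.rep_eq)
    then have 2: "snd (poly_op (q n) (?J o\<^sub>L ?J) z) = poly_op (q n) (?Q o\<^sub>L ?Q) (snd z)" for n z
      using poly_op_intertwine[of snd_blinfun "?J o\<^sub>L ?J" "?Q o\<^sub>L ?Q" "q n" z]
      by (simp add: snd_blinfun.rep_eq)
    have "(\<lambda>n. poly_op (q n) (?P o\<^sub>L ?P)) \<longlonglongrightarrow> ?P" "(\<lambda>n. poly_op (q n) (?Q o\<^sub>L ?Q)) \<longlonglongrightarrow> ?Q"
      by (rule positive_root_limit[OF P(1) q], simp) (rule positive_root_limit[OF Q(1) q], simp)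
    then have "(\<lambda>n. Re (cinner (poly_op (q n) (?P o\<^sub>L ?P) x) x) + Re (cinner (poly_op (q n) (?Q o\<^sub>L ?Q) y) y))
        \<longlonglongrightarrow> Re (cinner (?P x) x) + Re (cinner (?Q y) y)"
      by (intro tendsto_intros)
    then show "(\<lambda>n. Re (cinner (poly_op (?d n) ?J (x, y)) (x, y)))
        \<longlonglongrightarrow> Re (cinner (?P x) x) + Re (cinner (?Q y) y)"
      by (simp only: poly_op_pcompose_square cinner_prod_def 1 2 fst_conv snd_conv plus_complex.sel)
  qed
  ultimately show ?thesis by simp
qed

lemma discriminant_le:
  fixes a b m :: real
  assumes "\<And>t. 2 * (t * m) \<le> t\<^sup>2 * a + b" and "0 \<le> a" and "0 \<le> b"
  shows "m\<^sup>2 \<le> a * b"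
proof (cases "a = 0")
  case True
  have "m = 0"
  proof (rule ccontr)
    assume "m \<noteq> 0"
    then show False using assms(1)[of "(b + 1) / (2 * m)"] \<open>0 \<le> b\<close> True by simp
  qed
  then show ?thesis using True by simp
next
  case False
  have "2 * (m / a * m) \<le> (m / a)\<^sup>2 * a + b" by (rule assms(1))
  then show ?thesis using False \<open>0 \<le> a\<close> by (simp add: power2_eq_square field_simps)
qed

text \<open>
  The additive bound applied to \<open>t x\<close> and to a unimodular multiple of \<open>y\<close> is a quadratic
  inequality in \<open>t\<close>, whose discriminant is the multiplicative bound.
\<close>

lemma mixed_Schwarz:
  assumes A: "clinear_op A"
  shows "(cmod (cinner (blinfun_apply A x) y))\<^sup>2
    \<le> Re (cinner (abs_op A x) x) * Re (cinner (abs_op (adj A) y) y)"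
proof (rule discriminant_le)
  let ?w = "cinner (A x) y"
  have pos: "positive_op (abs_op A)" "positive_op (abs_op (adj A))"
    using positive_op_abs_op[OF A] positive_op_abs_op[OF clinear_op_adj[OF A]] by auto
  then show "0 \<le> Re (cinner (abs_op A x) x)" "0 \<le> Re (cinner (abs_op (adj A) y) y)"
    by (auto simp: positive_op_def)
  fix t :: real
  show "2 * (t * cmod ?w) \<le> t\<^sup>2 * Re (cinner (abs_op A x) x) + Re (cinner (abs_op (adj A) y) y)"
  proof (cases "?w = 0")
    case True
    then show ?thesis using pos by (simp add: positive_op_def)
  next
    case False
    \<comment> \<open>a unimodular factor makes the inner product equal to its modulus\<close>
    let ?c = "sgn ?w"
    have c: "?c * cnj ?c = 1"
      using False by (simp add: complex_norm_square[symmetric] norm_sgn)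
    have w: "cnj ?c * ?w = complex_of_real (cmod ?w)"
      using False by (simp add: sgn_div_norm complex_norm_square[symmetric] scaleR_conv_of_real
          power2_eq_square field_simps)
    have "2 * Re (cinner (A (t *\<^sub>R x)) (?c *C y))
      \<le> Re (cinner (abs_op A (t *\<^sub>R x)) (t *\<^sub>R x)) + Re (cinner (abs_op (adj A) (?c *C y)) (?c *C y))"
      by (rule mixed_arithmetic_mean[OF A])
    moreover have "cinner (A (t *\<^sub>R x)) (?c *C y) = t *\<^sub>R (cnj ?c * ?w)"
      by (simp add: blinfun.scaleR_right cinner_simps)
    moreover have "cinner (abs_op (adj A) (?c *C y)) (?c *C y)
        = (?c * cnj ?c) * cinner (abs_op (adj A) y) y"
      using positive_op_clinear[OF pos(2)] by (simp add: clinear_op_def cinner_simps mult_ac)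
    moreover have "cinner (abs_op A (t *\<^sub>R x)) (t *\<^sub>R x) = t\<^sup>2 *\<^sub>R cinner (abs_op A x) x"
      by (simp add: blinfun.scaleR_right cinner_simps power2_eq_square)
    ultimately show ?thesis unfolding c w by simp
  qed
qed

section \<open>Jensen's inequality\<close>

lemma powr_above_tangent:
  fixes a u r :: real
  assumes "0 \<le> a" "0 \<le> u" "1 \<le> r"
  shows "a powr r + r * a powr (r - 1) * (u - a) \<le> u powr r"
proof (cases "a = 0")
  case True
  then show ?thesis by simp
next
  case False
  with assms have a: "0 < a" by simp
  show ?thesis
  proof (cases "u = 0")
    case True
    have "a powr (r - 1) * a = a powr r" using a by (simp add: powr_diff)
    then have "a powr r + r * a powr (r - 1) * (u - a) = (1 - r) * a powr r"
      using True by (simp add: algebra_simps)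
    also have "\<dots> \<le> 0" using assms(3) by (intro mult_nonpos_nonneg) auto
    finally show ?thesis by (rule order_trans) simp
  next
    case False
    have "r * a powr (r - 1) * (u - a) \<le> u powr r - a powr r"
    proof (rule convex_on_imp_above_tangent[OF powr_convex[OF assms(3)]])
      show "((\<lambda>x. x powr r) has_real_derivative r * a powr (r - 1)) (at a within {0<..})"
        using has_real_derivative_powr[OF a] by (rule has_field_derivative_at_within)
    qed (use a False assms(2) in \<open>auto simp: interior_open\<close>)
    then show ?thesis by simp
  qed
qed

lemma powr_mean_le:
  fixes p q r :: real
  assumes "0 \<le> p" "0 \<le> q" "1 \<le> r"
  shows "((p + q) / 2) powr r \<le> (p powr r + q powr r) / 2"
proof -
  let ?m = "(p + q) / 2"
  let ?c = "r * ?m powr (r - 1)"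
  have "(?m powr r + ?c * (p - ?m)) + (?m powr r + ?c * (q - ?m)) \<le> p powr r + q powr r"
    using assms by (intro add_mono powr_above_tangent) auto
  moreover have "?c * (p - ?m) + ?c * (q - ?m) = 0"
    unfolding distrib_left[symmetric] by simp
  ultimately show ?thesis by simp
qed

text \<open>
  The tangent of \<open>u \<mapsto> u\<^sup>r\<close> at the value \<open>m\<close> of the left-hand sum, taken at \<open>u = t\<^sup>\<kappa>\<close>, gives an
  operator inequality for \<open>P\<close> and for \<open>Q\<close> separately; on a unit vector of the direct sum the
  linear terms add up to zero.
\<close>

lemma Jensen_direct_sum:
  assumes P: "positive_op P" and Q: "positive_op Q"
    and unit: "(norm x)\<^sup>2 + (norm y)\<^sup>2 = 1" and r: "1 \<le> r" and \<kappa>: "0 < \<kappa>"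
    and g: "\<And>t. 0 \<le> t \<Longrightarrow> poly g t = t powr \<kappa>"
  shows "(Re (cinner (poly_op g P x) x) + Re (cinner (poly_op g Q y) y)) powr r
    \<le> Re (cinner (powr_op P (\<kappa> * r) x) x) + Re (cinner (powr_op Q (\<kappa> * r) y) y)"
proof -
  let ?a = "Re (cinner (poly_op g P x) x)" and ?b = "Re (cinner (poly_op g Q y) y)"
  define m where "m = ?a + ?b"
  define c where "c = r * m powr (r - 1)"
  define q where "q = smult c g + [:m powr r - c * m:]"
  have "0 \<le> ?a" "0 \<le> ?b"
    using approx_spectrum_nonneg[OF P] approx_spectrum_nonneg[OF Q]
    by (auto intro!: poly_op_nonneg positive_op_self_adjoint P Q simp: g)
  then have m: "0 \<le> m" by (simp add: m_def)
  have q: "poly q t \<le> t powr (\<kappa> * r)" if "0 \<le> t" for t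
  proof -
    have "poly q t = m powr r + c * (t powr \<kappa> - m)"
      using g[OF that] by (simp add: q_def algebra_simps)
    also have "\<dots> \<le> (t powr \<kappa>) powr r"
      unfolding c_def using m r by (intro powr_above_tangent) auto
    finally show ?thesis by (simp add: powr_powr)
  qed
  have \<kappa>r: "0 < \<kappa> * r" using \<kappa> r by simp
  define d where "d = m powr r - c * m"
  have val: "Re (cinner (poly_op q T v) v) = c * Re (cinner (poly_op g T v) v) + d * (norm v)\<^sup>2"
    for T v
    by (simp add: q_def flip: d_def)
       (simp add: poly_op_add poly_op_smult poly_op_const blinfun.add_left
        blinfun.scaleR_left cinner_simps Re_cinner_self)
  have "Re (cinner (poly_op q P x) x) + Re (cinner (poly_op q Q y) y)
    \<le> Re (cinner (powr_op P (\<kappa> * r) x) x) + Re (cinner (powr_op Q (\<kappa> * r) y) y)"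
    by (intro add_mono powr_op_ge P Q \<kappa>r q)
  moreover have "Re (cinner (poly_op q P x) x) + Re (cinner (poly_op q Q y) y)
      = c * m + d * ((norm x)\<^sup>2 + (norm y)\<^sup>2)"
    unfolding val m_def by (simp add: distrib_left)
  ultimately show ?thesis unfolding unit m_def[symmetric] by (simp add: d_def)
qed

lemmas Jensen_direct_sum_linear =
  Jensen_direct_sum[where \<kappa> = 1 and g = "[:0, 1:]", unfolded poly_op_X, simplified]

lemma Jensen_direct_sum_square:
  assumes "positive_op P" "positive_op Q" "(norm x)\<^sup>2 + (norm y)\<^sup>2 = 1" "1 \<le> r"
  shows "(Re (cinner ((P o\<^sub>L P) x) x) + Re (cinner ((Q o\<^sub>L Q) y) y)) powr r
    \<le> Re (cinner (powr_op P (2 * r) x) x) + Re (cinner (powr_op Q (2 * r) y) y)"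
proof -
  have "poly ([:0, 1:] * [:0, 1:]) t = t powr 2" if "0 \<le> t" for t :: real
    using that by (simp add: power2_eq_square)
  then show ?thesis
    using Jensen_direct_sum[OF assms, of 2 "[:0, 1:] * [:0, 1:]"]
    by (simp only: poly_op_mult poly_op_X)
qed

section \<open>Numerical radius estimates\<close>

lemma Re_cinner_le_norm:
  "Re (cinner (blinfun_apply T x) x) \<le> norm T * (norm x)\<^sup>2"
proof -
  have "Re (cinner (T x) x) \<le> norm (T x) * norm x" by (rule Re_Cauchy_Schwarz)
  also have "\<dots> \<le> (norm T * norm x) * norm x"
    by (intro mult_right_mono norm_blinfun) simp
  finally show ?thesis by (simp add: power2_eq_square mult.assoc)
qed

lemma numerical_radius_bdd_above:
  "bdd_above (insert 0 {cmod (cinner (blinfun_apply T x) x) | x. norm x = 1})"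
proof (rule bdd_aboveI)
  fix c assume "c \<in> insert 0 {cmod (cinner (T x) x) | x. norm x = 1}"
  then consider "c = 0" | x where "norm x = 1" "c = cmod (cinner (T x) x)" by blast
  then show "c \<le> norm T"
  proof cases
    case 2
    then show ?thesis using Cauchy_Schwarz[of "T x" x] norm_blinfun[of T x] by simp
  qed simp
qed

lemma numerical_radius_nonneg: "0 \<le> numerical_radius T"
  unfolding numerical_radius_def by (rule cSup_upper[OF _ numerical_radius_bdd_above]) simp

lemma cmod_cinner_le_numerical_radius:
  "cmod (cinner (blinfun_apply T x) x) \<le> numerical_radius T * (norm x)\<^sup>2"
proof (cases "x = 0")
  case False
  let ?u = "(1 / norm x) *\<^sub>R x"
  have "norm ?u = 1" using False by simp
  then have "cmod (cinner (T ?u) ?u) \<le> numerical_radius T"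
    unfolding numerical_radius_def by (intro cSup_upper[OF _ numerical_radius_bdd_above]) blast
  moreover have "cmod (cinner (T ?u) ?u) = cmod (cinner (T x) x) / (norm x)\<^sup>2"
    by (simp add: blinfun.scaleR_right cinner_simps power2_eq_square)
  ultimately show ?thesis using False by (simp add: divide_le_eq)
qed simp

lemma numerical_radius_powr_le:
  assumes "\<And>x. norm x = 1 \<Longrightarrow> cmod (cinner (blinfun_apply T x) x) powr s \<le> R"
    and "0 \<le> R" and s: "0 < s"
  shows "numerical_radius T powr s \<le> R"
proof -
  have "numerical_radius T \<le> R powr (1 / s)"
    unfolding numerical_radius_def
  proof (rule cSup_least)
    fix c assume "c \<in> insert 0 {cmod (cinner (T x) x) | x. norm x = 1}"
    then consider "c = 0" | x where "norm x = 1" "c = cmod (cinner (T x) x)" by blast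
    then show "c \<le> R powr (1 / s)"
    proof cases
      case 2
      have "c = (c powr s) powr (1 / s)" using 2(2) s by (simp add: powr_powr)
      also have "\<dots> \<le> R powr (1 / s)" using assms(1)[OF 2(1)] 2(2) s by (intro powr_mono2) auto
      finally show ?thesis .
    qed simp
  qed simp
  then have "numerical_radius T powr s \<le> (R powr (1 / s)) powr s"
    using s numerical_radius_nonneg by (intro powr_mono2) auto
  then show ?thesis using s \<open>0 \<le> R\<close> by (simp add: powr_powr)
qed

text \<open>Apply the Cauchy--Schwarz inequality to \<open>b\<close> and the reflection \<open>2\<langle>a, e\<rangle>e - a\<close> of \<open>a\<close>.\<close>

lemma Buzano:
  assumes e: "norm (e::'a::complex_hilbert) = 1"
  shows "2 * cmod (cinner a e * cinner e b) \<le> norm a * norm b + cmod (cinner a b)"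
proof -
  let ?w = "cinner a e"
  let ?v = "(2 * ?w) *C e - a"
  have "cinner e a = cnj ?w" by (rule cinner_commute)
  then have "cinner ((2 * ?w) *C e) a = complex_of_real (2 * (cmod ?w)\<^sup>2)"
    by (simp only: cinner_scaleC_left of_real_mult complex_norm_square) simp
  then have "(norm ?v)\<^sup>2 = (norm a)\<^sup>2"
    using e by (simp add: norm_diff_sq norm_scaleC norm_mult power_mult_distrib)
  then have v: "norm ?v = norm a" by simp
  have "cinner ?v b = 2 * (?w * cinner e b) - cinner a b" by (simp add: cinner_simps)
  then have "2 * (?w * cinner e b) = cinner ?v b + cinner a b" by simp
  then have "cmod (2 * (?w * cinner e b)) \<le> cmod (cinner ?v b) + cmod (cinner a b)"
    by (simp only: norm_triangle_ineq)
  also have "cmod (cinner ?v b) \<le> norm a * norm b"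
    using Cauchy_Schwarz[of ?v b] v by simp
  finally show ?thesis by (simp add: norm_mult)
qed

lemma weighted_mean_le_max:
  fixes a b s t :: real
  assumes "0 \<le> s" "0 \<le> t" "s + t = 1"
  shows "a * s + b * t \<le> max a b"
proof -
  have "a * s + b * t \<le> max a b * s + max a b * t"
    using assms by (intro add_mono mult_right_mono) auto
  also have "\<dots> = max a b" using assms(3) by (simp flip: distrib_left)
  finally show ?thesis .
qed

lemma Re_cinner_direct_sum_le:
  assumes "(norm x)\<^sup>2 + (norm y)\<^sup>2 = 1"
  shows "Re (cinner (blinfun_apply S x) x) + Re (cinner (blinfun_apply R y) y) \<le> max (norm S) (norm R)"
  using add_mono[OF Re_cinner_le_norm[of S x] Re_cinner_le_norm[of R y]]
    weighted_mean_le_max[OF _ _ assms, of "norm S" "norm R"] by simp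

text \<open>
  The cross terms \<open>F G + G F\<close> of \<open>(F + G)\<^sup>2\<close> are twice the real part of \<open>F G\<close>; the real parts
  in the theorem come from here.
\<close>

lemma norm_sum_self_adjoint:
  assumes F: "self_adjoint F" and G: "self_adjoint G"
  shows "(norm ((F + G) x))\<^sup>2
    = Re (cinner (((F o\<^sub>L F) + (G o\<^sub>L G)) x) x) + 2 * Re (cinner (Re_op (F o\<^sub>L G) x) x)"
proof -
  have "adj (F o\<^sub>L G) = G o\<^sub>L F"
    by (rule adj_unique) (simp add: self_adjointD[OF F] self_adjointD[OF G])
  then show ?thesis
    using Re_cinner_commute[of "F x" "G x"]
    by (simp add: Re_op_def blinfun.add_left blinfun.scaleR_left cinner_simps norm_add_sq
        self_adjointD[OF F] self_adjointD[OF G] Re_cinner_self[symmetric])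
qed

lemma square_sum_le_product:
  fixes u v p q p' q' :: real
  assumes "u\<^sup>2 \<le> p * q" "v\<^sup>2 \<le> p' * q'" "0 \<le> p" "0 \<le> q" "0 \<le> p'" "0 \<le> q'"
  shows "(u + v)\<^sup>2 \<le> (p + p') * (q + q')"
proof -
  have "(2 * (u * v))\<^sup>2 = 4 * (u\<^sup>2 * v\<^sup>2)" by (simp add: power_mult_distrib)
  also have "\<dots> \<le> 4 * ((p * q) * (p' * q'))"
    using assms by (intro mult_left_mono mult_mono) auto
  also have "\<dots> = (p * q' + p' * q)\<^sup>2 - (p * q' - p' * q)\<^sup>2"
    by (simp add: power2_eq_square algebra_simps)
  also have "\<dots> \<le> (p * q' + p' * q)\<^sup>2" by simp
  finally have "2 * (u * v) \<le> p * q' + p' * q"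
    by (rule power2_le_imp_le) (use assms in auto)
  then show ?thesis using assms(1,2) by (simp add: power2_eq_square algebra_simps)
qed

lemma powr_two_times: "0 \<le> w \<Longrightarrow> w powr (2 * r) = (w\<^sup>2) powr (r::real)" for w :: real
  using powr_powr[of w 2 r] by simp

lemma product_powr_le_mean:
  fixes a b r :: real
  assumes "0 \<le> a" "0 \<le> b" "1 \<le> r"
  shows "(a * b) powr r \<le> ((a\<^sup>2) powr r + (b\<^sup>2) powr r) / 2"
proof -
  have "0 \<le> (a - b)\<^sup>2" by simp
  then have "a * b \<le> (a\<^sup>2 + b\<^sup>2) / 2" by (simp add: power2_eq_square algebra_simps)
  then have "(a * b) powr r \<le> ((a\<^sup>2 + b\<^sup>2) / 2) powr r"
    using assms by (intro powr_mono2) auto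
  also have "\<dots> \<le> ((a\<^sup>2) powr r + (b\<^sup>2) powr r) / 2"
    using assms by (intro powr_mean_le) auto
  finally show ?thesis .
qed

lemma norm_Pair_sq: "(norm (u, v))\<^sup>2 = (norm u)\<^sup>2 + (norm v)\<^sup>2"
  by (simp add: norm_Pair)

text \<open>
  The case \<open>\<alpha> = 0\<close>.  For \<open>T = antidiag_op A B\<close> and a unit vector \<open>e = (x, y)\<close>, Buzano's inequality
  with \<open>a = T e\<close> and \<open>b = T\<^sup>* e\<close> bounds \<open>\<bar>\<langle>T e, e\<rangle>\<bar>\<^sup>2\<close> by
  \<open>(\<parallel>T e\<parallel> \<parallel>T\<^sup>* e\<parallel> + \<bar>\<langle>T\<^sup>2 e, e\<rangle>\<bar>) / 2\<close>, where \<open>T\<^sup>2 = A B \<oplus> B A\<close>.  Convexity moves the power \<open>r\<close> to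
  the summands, and Jensen's inequality moves it into \<open>\<parallel>T e\<parallel>\<^sup>2 = \<langle>\<bar>T\<bar>\<^sup>2 e, e\<rangle>\<close>.
\<close>

lemma antidiag_Buzano_bound:
  assumes A: "clinear_op A" and B: "clinear_op B" and r: "1 \<le> r"
    and unit: "(norm x)\<^sup>2 + (norm y)\<^sup>2 = 1"
  shows "cmod (cinner (antidiag_op A B (x, y)) (x, y)) powr (2 * r)
    \<le> 1 / 4 * max (norm (powr_op (abs_op B) (2 * r) + powr_op (abs_op (adj A)) (2 * r)))
                  (norm (powr_op (abs_op A) (2 * r) + powr_op (abs_op (adj B)) (2 * r)))
      + 1 / 2 * max (numerical_radius (A o\<^sub>L B) powr r) (numerical_radius (B o\<^sub>L A) powr r)"
    (is "?w powr _ \<le> 1 / 4 * ?N + 1 / 2 * ?W")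
proof -
  let ?e = "(x, y)" and ?a = "(A y, B x)" and ?b = "(adj B y, adj A x)"
  note A' = clinear_op_adj[OF A] and B' = clinear_op_adj[OF B]
  note pos = positive_op_abs_op[OF A] positive_op_abs_op[OF B]
    positive_op_abs_op[OF A'] positive_op_abs_op[OF B']
  have unit': "(norm y)\<^sup>2 + (norm x)\<^sup>2 = 1" using unit by simp
  have e: "norm ?e = 1" using unit by (simp add: norm_prod_def)
  have w: "?w = cmod (cinner ?a ?e)" by simp
  have "cinner ?e ?b = cinner ?a ?e"
    by (simp add: cinner_prod_def cinner_adj_right[OF A] cinner_adj_right[OF B])
  moreover have ab: "cinner ?a ?b = cinner ((A o\<^sub>L B) x) x + cinner ((B o\<^sub>L A) y) y"
    by (simp add: cinner_prod_def cinner_adj_right[OF A] cinner_adj_right[OF B])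
  ultimately have buz: "?w\<^sup>2 \<le> (norm ?a * norm ?b + cmod (cinner ?a ?b)) / 2"
    using Buzano[OF e, of ?a ?b] by (simp add: w norm_mult power2_eq_square)
  have v: "cmod (cinner ?a ?b) powr r \<le> ?W"
  proof -
    have "cmod (cinner ?a ?b) \<le> cmod (cinner ((A o\<^sub>L B) x) x) + cmod (cinner ((B o\<^sub>L A) y) y)"
      unfolding ab by (rule norm_triangle_ineq)
    also have "\<dots> \<le> numerical_radius (A o\<^sub>L B) * (norm x)\<^sup>2 + numerical_radius (B o\<^sub>L A) * (norm y)\<^sup>2"
      by (intro add_mono cmod_cinner_le_numerical_radius)
    also have "\<dots> \<le> max (numerical_radius (A o\<^sub>L B)) (numerical_radius (B o\<^sub>L A))"
      by (rule weighted_mean_le_max[OF _ _ unit]) auto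
    finally have "cmod (cinner ?a ?b) powr r
        \<le> max (numerical_radius (A o\<^sub>L B)) (numerical_radius (B o\<^sub>L A)) powr r"
      using r by (intro powr_mono2) auto
    also have "\<dots> \<le> ?W" by (simp add: max_def)
    finally show ?thesis .
  qed
  have "(norm ?a)\<^sup>2 powr r \<le> Re (cinner (powr_op (abs_op A) (2 * r) y) y)
      + Re (cinner (powr_op (abs_op B) (2 * r) x) x)"
    using Jensen_direct_sum_square[OF pos(1,2) unit' r]
    by (simp only: norm_Pair_sq norm_abs_op[OF A] norm_abs_op[OF B])
  moreover have "(norm ?b)\<^sup>2 powr r \<le> Re (cinner (powr_op (abs_op (adj B)) (2 * r) y) y)
      + Re (cinner (powr_op (abs_op (adj A)) (2 * r) x) x)"
    using Jensen_direct_sum_square[OF pos(4,3) unit' r]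
    by (simp only: norm_Pair_sq norm_abs_op[OF A'] norm_abs_op[OF B'])
  ultimately have N: "(norm ?a)\<^sup>2 powr r + (norm ?b)\<^sup>2 powr r \<le> ?N"
    using Re_cinner_direct_sum_le[OF unit,
        of "powr_op (abs_op B) (2 * r) + powr_op (abs_op (adj A)) (2 * r)"
           "powr_op (abs_op A) (2 * r) + powr_op (abs_op (adj B)) (2 * r)"]
    by (simp add: blinfun.add_left cinner_simps)
  have "?w powr (2 * r) = (?w\<^sup>2) powr r" by (rule powr_two_times) simp
  also have "\<dots> \<le> ((norm ?a * norm ?b + cmod (cinner ?a ?b)) / 2) powr r"
    using buz r by (intro powr_mono2) auto
  also have "\<dots> \<le> ((norm ?a * norm ?b) powr r + cmod (cinner ?a ?b) powr r) / 2"
    using r by (intro powr_mean_le) auto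
  also have "\<dots> \<le> (((norm ?a)\<^sup>2 powr r + (norm ?b)\<^sup>2 powr r) / 2 + ?W) / 2"
    using r by (intro divide_right_mono add_mono product_powr_le_mean v) auto
  also have "\<dots> \<le> (?N / 2 + ?W) / 2"
    using N by (intro divide_right_mono add_right_mono) auto
  finally show ?thesis by (simp add: add_divide_distrib)
qed

text \<open>
  The case \<open>\<alpha> = 1\<close>.  The mixed Schwarz inequality for \<open>A\<close> and \<open>B\<close> and the Cauchy--Schwarz
  inequality for the two summands give \<open>\<bar>\<langle>T e, e\<rangle>\<bar>\<^sup>2 \<le> \<langle>\<bar>T\<bar> e, e\<rangle> \<langle>\<bar>T\<^sup>*\<bar> e, e\<rangle> = p q\<close>.  Jensen's
  inequality moves the power \<open>r\<close> into both factors, and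
  \<open>P Q \<le> (P + Q)\<^sup>2 / 4 \<le> \<parallel>(\<bar>T\<bar>\<^sup>r + \<bar>T\<^sup>*\<bar>\<^sup>r) e\<parallel>\<^sup>2 / 4\<close>, which is then expanded.
\<close>

lemma antidiag_Schwarz_bound:
  assumes A: "clinear_op A" and B: "clinear_op B" and r: "1 \<le> r"
    and unit: "(norm x)\<^sup>2 + (norm y)\<^sup>2 = 1"
  shows "cmod (cinner (antidiag_op A B (x, y)) (x, y)) powr (2 * r)
    \<le> 1 / 4 * max (norm (powr_op (abs_op B) (2 * r) + powr_op (abs_op (adj A)) (2 * r)))
                  (norm (powr_op (abs_op A) (2 * r) + powr_op (abs_op (adj B)) (2 * r)))
      + 1 / 2 * max (norm (Re_op (powr_op (abs_op B) r o\<^sub>L powr_op (abs_op (adj A)) r)))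
                    (norm (Re_op (powr_op (abs_op A) r o\<^sub>L powr_op (abs_op (adj B)) r)))"
    (is "?w powr _ \<le> 1 / 4 * ?N + 1 / 2 * ?M")
proof -
  note A' = clinear_op_adj[OF A] and B' = clinear_op_adj[OF B]
  note pos = positive_op_abs_op[OF A] positive_op_abs_op[OF B]
    positive_op_abs_op[OF A'] positive_op_abs_op[OF B']
  have unit': "(norm y)\<^sup>2 + (norm x)\<^sup>2 = 1" using unit by simp
  have r0: "0 < r" using r by simp
  let ?PA = "powr_op (abs_op A) r" and ?PB = "powr_op (abs_op B) r"
    and ?QA = "powr_op (abs_op (adj A)) r" and ?QB = "powr_op (abs_op (adj B)) r"
  define p where "p = Re (cinner (abs_op A y) y) + Re (cinner (abs_op B x) x)"
  define q where "q = Re (cinner (abs_op (adj B) y) y) + Re (cinner (abs_op (adj A) x) x)"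
  define P where "P = Re (cinner (?PA y) y) + Re (cinner (?PB x) x)"
  define Q where "Q = Re (cinner (?QB y) y) + Re (cinner (?QA x) x)"
  have nonneg: "0 \<le> Re (cinner (abs_op A y) y)" "0 \<le> Re (cinner (abs_op B x) x)"
    "0 \<le> Re (cinner (abs_op (adj A) x) x)" "0 \<le> Re (cinner (abs_op (adj B) y) y)"
    using pos by (auto simp: positive_op_def)
  have pq: "0 \<le> p" "0 \<le> q" using nonneg by (auto simp: p_def q_def)
  have "p powr r \<le> P"
    unfolding p_def P_def by (rule Jensen_direct_sum_linear[OF pos(1,2) unit' r])
  moreover have "q powr r \<le> Q"
    unfolding q_def Q_def by (rule Jensen_direct_sum_linear[OF pos(4,3) unit' r])
  ultimately have PQ: "(p * q) powr r \<le> P * Q"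
    using pq by (simp add: powr_mult mult_mono')
  have "?w \<le> cmod (cinner (A y) x) + cmod (cinner (B x) y)"
    by (simp add: cinner_prod_def norm_triangle_ineq)
  then have "?w\<^sup>2 \<le> (cmod (cinner (A y) x) + cmod (cinner (B x) y))\<^sup>2"
    by (intro power_mono) auto
  also have "\<dots> \<le> p * q"
    using square_sum_le_product[OF mixed_Schwarz[OF A, of y x] mixed_Schwarz[OF B, of x y]] nonneg
    by (simp add: p_def q_def add.commute)
  finally have w: "?w\<^sup>2 \<le> p * q" .
  let ?S = "?PB + ?QA" and ?R = "?PA + ?QB"
  have "P + Q = Re (cinner (?S x, ?R y) (x, y))"
    by (simp add: P_def Q_def cinner_prod_def blinfun.add_left cinner_simps)
  also have "\<dots> \<le> norm (?S x, ?R y) * norm (x, y)" by (rule Re_Cauchy_Schwarz)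
  also have "norm (x, y) = 1" using unit by (simp add: norm_prod_def)
  finally have "P + Q \<le> norm (?S x, ?R y)" by simp
  moreover have "0 \<le> P + Q"
    using powr_op_nonneg[OF pos(1) r0] powr_op_nonneg[OF pos(2) r0]
      powr_op_nonneg[OF pos(3) r0] powr_op_nonneg[OF pos(4) r0]
    by (simp add: P_def Q_def)
  ultimately have "(P + Q)\<^sup>2 \<le> (norm (?S x, ?R y))\<^sup>2" by (intro power_mono)
  also have "\<dots> = (norm (?S x))\<^sup>2 + (norm (?R y))\<^sup>2" by (simp add: norm_prod_def)
  also have "\<dots> = (Re (cinner ((powr_op (abs_op B) (2 * r) + powr_op (abs_op (adj A)) (2 * r)) x) x)
        + Re (cinner ((powr_op (abs_op A) (2 * r) + powr_op (abs_op (adj B)) (2 * r)) y) y))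
      + 2 * (Re (cinner (Re_op (?PB o\<^sub>L ?QA) x) x) + Re (cinner (Re_op (?PA o\<^sub>L ?QB) y) y))"
    by (simp only: norm_sum_self_adjoint self_adjoint_powr_op pos r0 powr_op_double) simp
  also have "\<dots> \<le> ?N + 2 * ?M"
    by (intro add_mono mult_left_mono Re_cinner_direct_sum_le unit) simp
  finally have sum: "(P + Q)\<^sup>2 \<le> ?N + 2 * ?M" .
  have "?w powr (2 * r) = (?w\<^sup>2) powr r" by (rule powr_two_times) simp
  also have "\<dots> \<le> (p * q) powr r" using w r by (intro powr_mono2) auto
  also have "\<dots> \<le> P * Q" by (rule PQ)
  also have "\<dots> \<le> (P + Q)\<^sup>2 / 4"
    using zero_le_power2[of "P - Q"] by (simp add: power2_eq_square algebra_simps)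
  also have "\<dots> \<le> (?N + 2 * ?M) / 4" using sum by simp
  finally show ?thesis by (simp add: add_divide_distrib)
qed

theorem theorem2p5:
  fixes A B :: "'a::complex_hilbert \<Rightarrow>\<^sub>L 'a" and \<alpha> r :: real
  assumes "clinear_op A" and "clinear_op B"
    and "0 \<le> \<alpha>" and "\<alpha> \<le> 1" and "1 \<le> r"
  shows "numerical_radius (antidiag_op A B) powr (2 * r)
    \<le> 1 / 4 * max (norm (powr_op (abs_op B) (2 * r) + powr_op (abs_op (adj A)) (2 * r)))
                  (norm (powr_op (abs_op A) (2 * r) + powr_op (abs_op (adj B)) (2 * r)))
      + (1 - \<alpha>) / 2 * max (numerical_radius (A o\<^sub>L B) powr r) (numerical_radius (B o\<^sub>L A) powr r)
      + \<alpha> / 2 * max (norm (Re_op (powr_op (abs_op B) r o\<^sub>L powr_op (abs_op (adj A)) r)))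
                    (norm (Re_op (powr_op (abs_op A) r o\<^sub>L powr_op (abs_op (adj B)) r)))"
    (is "_ \<le> 1 / 4 * ?N + (1 - \<alpha>) / 2 * ?W + \<alpha> / 2 * ?M")
proof (rule numerical_radius_powr_le)
  fix z :: "'a \<times> 'a"
  assume z: "norm z = 1"
  obtain x y where xy: "z = (x, y)" by (cases z)
  have unit: "(norm x)\<^sup>2 + (norm y)\<^sup>2 = 1"
    using z by (simp add: xy norm_prod_def)
  let ?c = "cmod (cinner (antidiag_op A B z) z) powr (2 * r)"
  have "?c = (1 - \<alpha>) * ?c + \<alpha> * ?c" by (simp add: algebra_simps)
  also have "\<dots> \<le> (1 - \<alpha>) * (1 / 4 * ?N + 1 / 2 * ?W) + \<alpha> * (1 / 4 * ?N + 1 / 2 * ?M)"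
    unfolding xy using assms
    by (intro add_mono mult_left_mono antidiag_Buzano_bound antidiag_Schwarz_bound unit) auto
  also have "\<dots> = 1 / 4 * ?N + (1 - \<alpha>) / 2 * ?W + \<alpha> / 2 * ?M"
    by (simp add: field_simps)
  finally show "?c \<le> 1 / 4 * ?N + (1 - \<alpha>) / 2 * ?W + \<alpha> / 2 * ?M" .
next
  have "0 \<le> ?N" "0 \<le> ?W" "0 \<le> ?M" by (auto simp: le_max_iff_disj)
  then show "0 \<le> 1 / 4 * ?N + (1 - \<alpha>) / 2 * ?W + \<alpha> / 2 * ?M"
    using assms by (intro add_nonneg_nonneg mult_nonneg_nonneg) auto
qed (use assms in simp)

end
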